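(* Every planar graph without isolated vertices admits an open-neighborhood conflict-free coloring using at most eight colors.
   Context: For a vertex $v$ of a simple graph $G$, $N(v)$ denotes the set of neighbors of $v$ (not including $v$). An open-neighborhood conflict-free $k$-coloring of $G$ is a map $\chi: V'\to\{1,\dots,k\}$ defined on a subset $V'\subseteq V(G)$ (other vertices uncolored) such that for every $v\in V(G)$ there is $w\in N(v)\cap V'$ whose color is different from the colors of all other vertices in $N(v)\cap V'$. *)

theory Defs
  imports "HOL-Analysis.Analysis" "Graph_Theory.Pair_Digraph"
begin

text \<open>
  Finite simple graphs are the symmetric, loop-free finite digraphs of
  \<^locale>\<open>pair_graph\<close>: an undirected edge \<open>uv\<close> is the pair of arcs \<open>(u, v)\<close> and \<open>(v, u)\<close>.
\<close>

definition neighbors :: "'a pair_pre_digraph \<Rightarrow> 'a \<Rightarrow> 'a set" where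
  "neighbors G v = {w. (v, w) \<in> parcs G}"

text \<open>
  The plane is the type \<^typ>\<open>complex\<close>. The two arcs \<open>(u, v)\<close> and \<open>(v, u)\<close> of an
  undirected edge are drawn as the same curve, traversed in opposite directions.
\<close>

definition plane_drawing ::
    "'a pair_pre_digraph \<Rightarrow> ('a \<Rightarrow> complex) \<Rightarrow> ('a \<times> 'a \<Rightarrow> real \<Rightarrow> complex) \<Rightarrow> bool" where
  "plane_drawing G p \<gamma> \<longleftrightarrow>
     inj_on p (pverts G) \<and>
     (\<forall>(u, v) \<in> parcs G.
        arc (\<gamma> (u, v)) \<and> pathstart (\<gamma> (u, v)) = p u \<and> pathfinish (\<gamma> (u, v)) = p v \<and>
        \<gamma> (v, u) = reversepath (\<gamma> (u, v)) \<and>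
        path_image (\<gamma> (u, v)) \<inter> p ` pverts G = {p u, p v}) \<and>
     (\<forall>(u, v) \<in> parcs G. \<forall>(x, y) \<in> parcs G. {u, v} \<noteq> {x, y} \<longrightarrow>
        path_image (\<gamma> (u, v)) \<inter> path_image (\<gamma> (x, y)) \<subseteq> p ` ({u, v} \<inter> {x, y}))"

definition planar :: "'a pair_pre_digraph \<Rightarrow> bool" where
  "planar G \<longleftrightarrow> (\<exists>p \<gamma>. plane_drawing G p \<gamma>)"

text \<open>
  A partial colouring is a map \<open>c\<close> whose domain \<^term>\<open>dom c\<close> is the set of coloured vertices.
\<close>

definition open_conflict_free_coloring ::
    "'a pair_pre_digraph \<Rightarrow> nat \<Rightarrow> ('a \<Rightarrow> nat option) \<Rightarrow> bool" where
  "open_conflict_free_coloring G k c \<longleftrightarrow>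
     dom c \<subseteq> pverts G \<and> ran c \<subseteq> {1..k} \<and>
     (\<forall>v \<in> pverts G. \<exists>w \<in> neighbors G v \<inter> dom c.
        \<forall>w' \<in> neighbors G v \<inter> dom c. w' \<noteq> w \<longrightarrow> c w' \<noteq> c w)"

end

theory Submission
  imports Defs
begin

text \<open>
  Let \<open>X\<close> be a maximal set of vertices at pairwise distance at least three and \<open>N\<close> its set of
  neighbors. Every vertex of \<open>N\<close> has exactly one neighbor in \<open>X\<close>, so giving all of \<open>X\<close> the color 8
  settles \<open>N\<close>. Every other vertex \<open>w\<close> has a neighbor \<open>f w\<close> in \<open>N\<close>; contracting \<open>w\<close> into \<open>f w\<close> and
  coloring the resulting minor properly with the colors 1 to 7 makes \<open>f w\<close> the witness for \<open>w\<close>.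

  Seven colors suffice for a graph without a \<open>K\<^sub>5\<close> minor, without the Four Color Theorem: by
  Mader's density argument it has a vertex \<open>v\<close> of degree at most 7, and if the degree is exactly 7
  then contracting \<open>v\<close> with two nonadjacent neighbors saves a color at \<open>v\<close>.

  A \<open>K\<^sub>5\<close> minor of a plane graph yields a plane drawing of \<open>K\<^sub>5\<close> or of \<open>K\<^sub>3\<^sub>,\<^sub>3\<close>: in each branch set
  the four attachment points are joined either by a star or by a tree of the shape of the letter H,
  and an H turns the model into one of \<open>K\<^sub>3\<^sub>,\<^sub>3\<close>. Both graphs have a Hamiltonian cycle, which becomes a Jordan
  curve; interleaved chords lie on opposite sides of it, which is impossible by parity.
\<close>

text \<open>The coloring argument contracts edges in three places: to build the minor on the
  witnesses, to thin out a dense graph, and to merge two neighbors with \<open>v\<close>. Rather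
  than redraw a plane graph after each contraction, planarity is used once, in
  \<open>plane_graph_no_K5_minor\<close>; everything else works with the combinatorial property of
  having no \<open>K\<^sub>5\<close> minor, which \<open>clique_minor_lift\<close> carries through
  contractions. The price is that the topology has to cope with minors, not just subdivisions. A
  branch set with three terminals always contains a tripod, but one with four may offer only an H. A
  single H is enough: cutting its branch set at the bridge leaves six branch sets that form a model
  of \<open>K\<^sub>3\<^sub>,\<^sub>3\<close>, and there every vertex has degree three, so that no
  second H has to be treated. The constant is 8 = 7 + 1. The 7 comes from \<open>2 ^ 3\<close>:
  minimum degree 8 forces a \<open>K\<^sub>5\<close> minor, so some vertex has degree at most
  7.\<close>

section \<open>Chords of a Jordan curve\<close>

text \<open>
  Janiszewski's theorem is applied to the two closed curves formed by \<open>\<gamma>\<close> with \<open>\<alpha>\<close> and with \<open>\<beta>\<close>.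
  Neither separates a point of the empty side \<open>O2\<close> from an interior point of \<open>\<delta>\<close>: leave \<open>O2\<close>
  across the other half of the cycle and follow \<open>\<delta>\<close>. Hence their union does not either, although it
  contains the whole cycle.
\<close>

lemma crossing_chords_meet:
  fixes \<alpha> \<beta> \<gamma> \<delta> :: "real \<Rightarrow> complex"
  assumes arcs: "arc \<alpha>" "arc \<beta>" "arc \<gamma>" "arc \<delta>"
    and ends: "pathstart \<alpha> = a" "pathfinish \<alpha> = b" "pathstart \<beta> = b" "pathfinish \<beta> = a"
      "pathstart \<gamma> = a" "pathfinish \<gamma> = b" "pathstart \<delta> = c" "pathfinish \<delta> = d"
    and cycle: "path_image \<alpha> \<inter> path_image \<beta> = {a, b}"
    and c: "c \<in> path_image \<alpha> - {a, b}" and d: "d \<in> path_image \<beta> - {a, b}"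
    and disj: "path_image \<gamma> \<inter> path_image \<delta> = {}"
    and side: "O1 = inside (path_image \<alpha> \<union> path_image \<beta>) \<and> O2 = outside (path_image \<alpha> \<union> path_image \<beta>)
      \<or> O2 = inside (path_image \<alpha> \<union> path_image \<beta>) \<and> O1 = outside (path_image \<alpha> \<union> path_image \<beta>)"
    and sub: "path_image \<gamma> - {a, b} \<subseteq> O1" "path_image \<delta> - {c, d} \<subseteq> O1"
  shows False
proof -
  let ?A = "path_image \<alpha>" and ?B = "path_image \<beta>" and ?C = "path_image \<gamma>" and ?D = "path_image \<delta>"
  have sp: "simple_path (\<alpha> +++ \<beta>)"
    using arcs ends cycle by (intro simple_path_join_loop) auto
  have im: "path_image (\<alpha> +++ \<beta>) = ?A \<union> ?B"
    using ends by (simp add: path_image_join)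
  have J: "connected O2" "O2 \<noteq> {}" "open O1" "open O2" "O1 \<inter> O2 = {}" "O1 \<union> O2 = - (?A \<union> ?B)" "frontier O2 = ?A \<union> ?B"
    using Jordan_inside_outside[OF sp] side ends unfolding im by (simp_all, (elim disjE conjE; simp add: Int_commute Un_commute)+)
  have ab: "a \<noteq> b"
    using arcs(1) ends arc_distinct_ends by blast
  have cd: "c \<noteq> d"
    using arcs(4) ends arc_distinct_ends by blast
  obtain p where p: "p \<in> O2"
    using J by blast
  have "?D - {c, d} \<noteq> {}"
    by (metis nonempty_simple_path_endless arc_imp_simple_path arcs(4) ends(7,8))
  then obtain q where q: "q \<in> ?D" "q \<noteq> c" "q \<noteq> d"
    by auto
  have clo: "closure O2 = O2 \<union> ?A \<union> ?B"
    using J(7) closure_Un_frontier[of O2] by blast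
  have conD: "connected (?D - {d})" "connected (?D - {c})"
  proof -
    have con: "connected (\<delta> ` {0..<1})" "connected (\<delta> ` {0<..1})"
      using arc_imp_path[OF arcs(4)]
      by (auto intro!: connected_continuous_image intro: continuous_on_subset simp: path_def)
    have inj: "inj_on \<delta> {0..1}"
      using arcs(4) by (simp add: arc_def)
    have "\<delta> ` {0..<1} = \<delta> ` ({0..1} - {1})" "\<delta> ` {0<..1} = \<delta> ` ({0..1} - {0})"
      by (intro arg_cong[of _ _ "image \<delta>"]; force)+
    moreover have "\<delta> ` ({0..1} - {1}) = ?D - {d}" "\<delta> ` ({0..1} - {0}) = ?D - {c}"
      using ends inj_on_image_set_diff[OF inj] 
      by (auto simp: path_image_def pathstart_def pathfinish_def)
    ultimately show "connected (?D - {d})" "connected (?D - {c})"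
      using con by simp_all
  qed
  have inD: "c \<in> ?D" "d \<in> ?D" "a \<in> ?C" "b \<in> ?C" "a \<in> ?A" "b \<in> ?A" "a \<in> ?B" "b \<in> ?B"
    using ends pathstart_in_path_image pathfinish_in_path_image by metis+
  \<comment> \<open>\<open>X\<close> is the half of the cycle that closes up with \<gamma>, and
    \<open>Y\<close> is the half left open. \<open>e\<close> is the end of \<delta> on
    \<open>Y\<close>; the other end \<open>f\<close> lies on \<open>X\<close> and is removed. Adding
    points of the frontier keeps \<open>O2\<close> connected.\<close>
  have conn: "connected_component (- (?C \<union> X)) p q"
    if X: "X \<union> Y = ?A \<union> ?B" "X \<inter> Y = {a, b}" "e \<in> Y - {a, b}" "{e, f} = {c, d}"
      "connected (?D - {f})" for X Y e f
  proof -
    have 1: "connected (O2 \<union> (Y - {a, b}))"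
    proof (rule connected_intermediate_closure[OF J(1)])
      show "O2 \<union> (Y - {a, b}) \<subseteq> closure O2"
        unfolding clo using X(1) by blast
    qed auto
    have "connected ((O2 \<union> (Y - {a, b})) \<union> (?D - {f}))"
    proof (rule connected_Un[OF 1 X(5)])
      have "e \<noteq> f"
        using cd X(4) by force
      moreover have "e \<in> ?D"
        using inD X(4) by (metis doubleton_eq_iff)
      ultimately show "(O2 \<union> (Y - {a, b})) \<inter> (?D - {f}) \<noteq> {}"
        using X(3) by blast
    qed
    moreover have "(O2 \<union> (Y - {a, b})) \<union> (?D - {f}) \<subseteq> - (?C \<union> X)"
    proof -
      have "?C \<subseteq> insert a (insert b O1)"
        using sub(1) by blast
      then have "O2 \<inter> (?C \<union> X) = {}"
        using J(5,6) X(1) inD by blast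
      moreover have "(Y - {a, b}) \<inter> (?C \<union> X) = {}"
        using \<open>?C \<subseteq> insert a (insert b O1)\<close> J(6) X(1,2) by blast
      moreover have "(?D - {f}) \<inter> X = {}"
      proof -
        have "?D - {f} \<subseteq> insert e O1"
          using sub(2) X(4) by blast
        then show ?thesis
          using X(1,2,3) J(6) by blast
      qed
      ultimately show ?thesis
        using disj by blast
    qed
    moreover have "p \<in> (O2 \<union> (Y - {a, b})) \<union> (?D - {f})" "q \<in> (O2 \<union> (Y - {a, b})) \<union> (?D - {f})"
      using p q X(4) by auto
    ultimately show ?thesis
      unfolding connected_component_def by blast
  qed
  have "connected_component (- ((?C \<union> ?A) \<union> (?C \<union> ?B))) p q"
  proof (rule Janiszewski)
    have "(?C \<union> ?A) \<inter> (?C \<union> ?B) = ?C \<union> ?A \<inter> ?B"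
      by blast
    also have "\<dots> = ?C"
      using cycle inD by auto
    finally have "(?C \<union> ?A) \<inter> (?C \<union> ?B) = ?C" .
    then show "connected ((?C \<union> ?A) \<inter> (?C \<union> ?B))"
      using arcs connected_arc_image by simp
    show "connected_component (- (?C \<union> ?A)) p q"
      using conn[of ?A ?B d c] cycle d conD by (simp add: insert_commute)
    show "connected_component (- (?C \<union> ?B)) p q"
      using conn[of ?B ?A c d] cycle c conD by (simp add: Un_commute Int_commute)
  qed (use arcs in \<open>auto simp: compact_arc_image closed_arc_image\<close>)
  then have "connected_component (O1 \<union> O2) p q"
    using connected_component_mono[of "- ((?C \<union> ?A) \<union> (?C \<union> ?B))" "O1 \<union> O2"] J(6) by blast
  then obtain T where T: "connected T" "T \<subseteq> O1 \<union> O2" "p \<in> T" "q \<in> T"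
    unfolding connected_component_def by blast
  then have "O1 \<inter> T = {} \<or> O2 \<inter> T = {}"
    using J by (metis connectedD inf_sup_aci(1) inf_bot_right inf_commute inf_assoc)
  moreover have "q \<in> O1"
    using q sub by blast
  ultimately show False
    using T p by blast
qed


section \<open>Polygons and their chords\<close>

text \<open>In the applications \<open>v\<close> and \<open>e\<close> are composed with
  \<open>mod n\<close> and the window \<open>{i..<j}\<close> may run past \<open>n\<close>, because
  one half of a polygon wraps around. So all assumptions concern the window only.\<close>

lemma arc_chain:
  fixes v :: "nat \<Rightarrow> 'a::real_normed_vector"
  assumes "i < j"
    and e: "\<And>k. i \<le> k \<Longrightarrow> k < j \<Longrightarrow> arc (e k) \<and> pathstart (e k) = v k \<and> pathfinish (e k) = v (Suc k)"
    and meet: "\<And>k l. i \<le> k \<Longrightarrow> k < l \<Longrightarrow> l < j \<Longrightarrow>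
      path_image (e k) \<inter> path_image (e l) \<subseteq> (if l = Suc k then {v l} else {})"
  shows "\<exists>g. arc g \<and> pathstart g = v i \<and> pathfinish g = v j \<and> path_image g = (\<Union>k\<in>{i..<j}. path_image (e k))"
proof -
  show ?thesis
    using assms
  proof (induction j)
    case (Suc j)
    show ?case
    proof (cases "i = j")
      case True
      then show ?thesis
        using Suc.prems(2)[of j] by auto
    next
      case False
      then have ij: "i < j"
        using Suc.prems(1) by simp
      have "\<exists>g. arc g \<and> pathstart g = v i \<and> pathfinish g = v j \<and> path_image g = (\<Union>k\<in>{i..<j}. path_image (e k))"
        using Suc.IH[OF ij Suc.prems(2,3)] ij by simp
      then obtain g where g: "arc g" "pathstart g = v i" "pathfinish g = v j"
        "path_image g = (\<Union>k\<in>{i..<j}. path_image (e k))"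
        by blast
      have ej: "arc (e j)" "pathstart (e j) = v j" "pathfinish (e j) = v (Suc j)"
        using Suc.prems(2)[of j] ij by auto
      have "path_image g \<inter> path_image (e j) \<subseteq> {v j}"
        using Suc.prems(3)[of _ j] unfolding g(4) by (fastforce split: if_splits)
      then have "arc (g +++ e j)"
        using g ej by (intro arc_join) auto
      moreover have "path_image (g +++ e j) = (\<Union>k\<in>{i..<Suc j}. path_image (e k))"
        using g ej ij by (simp add: path_image_join atLeastLessThanSuc Un_commute)
      ultimately show ?thesis
        using g ej by (intro exI[of _ "g +++ e j"]) simp
    qed
  qed simp
qed

lemma mod_neq_of_close:
  fixes k l n :: nat
  assumes "k < l" "l < k + n"
  shows "k mod n \<noteq> l mod n"
proof
  assume "k mod n = l mod n"
  then have "n dvd l - k"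
    using assms by (metis less_imp_le mod_eq_dvd_iff_nat)
  then show False
    using assms by (auto dest: dvd_imp_le)
qed

text \<open>The corners \<open>v i\<close> and \<open>v j\<close> cut the polygon into two arcs; by
  \<open>ord\<close> one contains \<open>v c\<close> and the other \<open>v d\<close>, which is the
  situation of \<open>crossing_chords_meet\<close>.\<close>

lemma polygon_chords_same_side:
  fixes v :: "nat \<Rightarrow> complex"
  defines "P \<equiv> (\<lambda>e n. \<Union>k<n. path_image (e k))"
  assumes v: "inj_on v {..<n}"
    and e: "\<And>k. k < n \<Longrightarrow> arc (e k) \<and> pathstart (e k) = v k \<and> pathfinish (e k) = v (Suc k mod n)"
    and meet: "\<And>k l. k < n \<Longrightarrow> l < n \<Longrightarrow> k \<noteq> l \<Longrightarrow>
      path_image (e k) \<inter> path_image (e l) \<subseteq> v ` ({k, Suc k mod n} \<inter> {l, Suc l mod n})"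
    and ord: "i < c" "c < j" "j < d" "d < n"
    and \<gamma>: "arc \<gamma>" "pathstart \<gamma> = v i" "pathfinish \<gamma> = v j"
    and \<delta>: "arc \<delta>" "pathstart \<delta> = v c" "pathfinish \<delta> = v d"
    and disj: "path_image \<gamma> \<inter> path_image \<delta> = {}"
    and side: "U = inside (P e n) \<or> U = outside (P e n)"
    and sub: "path_image \<gamma> - {v i, v j} \<subseteq> U" "path_image \<delta> - {v c, v d} \<subseteq> U"
  shows False
proof -
  let ?v = "\<lambda>k. v (k mod n)" and ?e = "\<lambda>k. e (k mod n)"
  have n0: "0 < n"
    using ord by simp
  have e': "arc (?e k) \<and> pathstart (?e k) = ?v k \<and> pathfinish (?e k) = ?v (Suc k)" for k
    using e[of "k mod n"] n0 by (simp add: mod_Suc_eq)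
  \<comment> \<open>The extra set accounts for a full turn: if \<open>l = k + n - 1\<close>, the
    edge \<open>l\<close> ends at the corner where \<open>k\<close> begins, although
    \<open>Suc l\<close> and \<open>k\<close> differ as numbers.\<close>
  have meet': "path_image (?e k) \<inter> path_image (?e l) \<subseteq> ?v ` ({k, Suc k} \<inter> {l, Suc l} \<union> {x\<in>{k}. l = k + n - 1})"
    if kl: "k < l" "l < k + n" for k l
  proof -
    have "path_image (?e k) \<inter> path_image (?e l)
        \<subseteq> v ` ({k mod n, Suc k mod n} \<inter> {l mod n, Suc l mod n})"
      using meet[of "k mod n" "l mod n"] n0 mod_neq_of_close[OF kl] by (simp add: mod_Suc_eq)
    moreover have "Suc k mod n \<noteq> Suc l mod n"
      using mod_neq_of_close[of "Suc k" "Suc l" n] kl by simp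
    moreover have "Suc k = l" if "Suc k mod n = l mod n"
      using mod_neq_of_close[of "Suc k" l n] kl that by force
    moreover have "l = k + n - 1" if "k mod n = Suc l mod n"
      using mod_neq_of_close[of k "Suc l" n] kl that by force
    ultimately show ?thesis
      using mod_neq_of_close[OF kl] by auto
  qed
  have "\<exists>g. arc g \<and> pathstart g = ?v i \<and> pathfinish g = ?v j \<and> path_image g = (\<Union>k\<in>{i..<j}. path_image (?e k))"
  proof (rule arc_chain[where v = ?v and e = ?e])
    fix k l assume "i \<le> k" "k < l" "l < j"
    then show "path_image (?e k) \<inter> path_image (?e l) \<subseteq> (if l = Suc k then {?v l} else {})"
      using meet'[of k l] ord by (auto split: if_splits)
  qed (use ord in simp, rule e')
  then obtain \<alpha> where \<alpha>: "arc \<alpha>" "pathstart \<alpha> = v i" "pathfinish \<alpha> = v j"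
    "path_image \<alpha> = (\<Union>k\<in>{i..<j}. path_image (?e k))"
    using ord by auto
  have "\<exists>g. arc g \<and> pathstart g = ?v j \<and> pathfinish g = ?v (i + n) \<and> path_image g = (\<Union>k\<in>{j..<i+n}. path_image (?e k))"
  proof (rule arc_chain[where v = ?v and e = ?e])
    fix k l assume "j \<le> k" "k < l" "l < i + n"
    then show "path_image (?e k) \<inter> path_image (?e l) \<subseteq> (if l = Suc k then {?v l} else {})"
      using meet'[of k l] ord by (auto split: if_splits)
  qed (use ord in simp, rule e')
  then obtain \<beta> where \<beta>: "arc \<beta>" "pathstart \<beta> = v j" "pathfinish \<beta> = v i"
    "path_image \<beta> = (\<Union>k\<in>{j..<i+n}. path_image (?e k))"
    using ord by auto
  have P: "path_image \<alpha> \<union> path_image \<beta> = P e n"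
  proof -
    have "path_image \<alpha> \<union> path_image \<beta> = (\<Union>k\<in>{i..<i+n}. path_image (?e k))"
    proof -
      have "{i..<i+n} = {i..<j} \<union> {j..<i+n}"
        using ord by auto
      then show ?thesis
        unfolding \<alpha>(4) \<beta>(4) by (simp only: UN_Un)
    qed
    also have "\<dots> = \<Union> ((\<lambda>k. path_image (e k)) ` ((\<lambda>k. k mod n) ` {i..<i+n}))"
      by (simp add: image_image)
    also have "(\<lambda>k. k mod n) ` {i..<i+n} = {..<n}"
    proof -
      have "inj_on (\<lambda>k. k mod n) {i..<i+n}"
        using mod_neq_of_close[of _ _ n] by (intro linorder_inj_onI) auto
      then have "card ((\<lambda>k. k mod n) ` {i..<i+n}) = n"
        by (simp add: card_image)
      then show ?thesis
        using n0 by (intro card_subset_eq) auto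
    qed
    finally show ?thesis
      by (simp add: P_def)
  qed
  have v_eq: "v x = v y \<longleftrightarrow> x = y" if "x < n" "y < n" for x y
    using v that by (auto dest: inj_onD)
  have "path_image \<alpha> \<inter> path_image \<beta> \<subseteq> {v i, v j}"
  proof
    fix z assume "z \<in> path_image \<alpha> \<inter> path_image \<beta>"
    then obtain k l where kl: "i \<le> k" "k < j" "j \<le> l" "l < i + n" "z \<in> path_image (?e k) \<inter> path_image (?e l)"
      unfolding \<alpha>(4) \<beta>(4) by auto
    then have "z \<in> ?v ` ({k, Suc k} \<inter> {l, Suc l} \<union> {x\<in>{k}. l = k + n - 1})"
      using meet'[of k l] ord by auto
    then obtain x where x: "z = ?v x" "x \<in> {k, Suc k} \<inter> {l, Suc l} \<union> {x\<in>{k}. l = k + n - 1}"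
      by blast
    then have "x = j \<or> x = i"
      using kl ord by auto
    then show "z \<in> {v i, v j}"
      using x(1) ord by auto
  qed
  moreover have "v i \<in> path_image \<alpha>" "v j \<in> path_image \<alpha>" "v j \<in> path_image \<beta>" "v i \<in> path_image \<beta>"
    using \<alpha>(2,3) \<beta>(2,3) pathstart_in_path_image pathfinish_in_path_image by metis+
  ultimately have cyc: "path_image \<alpha> \<inter> path_image \<beta> = {v i, v j}"
    by blast
  have in_e: "v k \<in> path_image (?e k)" if "k < n" for k
    using e'[of k] pathstart_in_path_image[of "?e k"] that by simp
  have "v c \<in> path_image \<alpha>"
    unfolding \<alpha>(4) using ord in_e[of c] by (intro UN_I[of c]) simp_all
  moreover have "v d \<in> path_image \<beta>"
    unfolding \<beta>(4) using ord in_e[of d] by (intro UN_I[of d]) simp_all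
  ultimately have vc: "v c \<in> path_image \<alpha> - {v i, v j}" and vd: "v d \<in> path_image \<beta> - {v i, v j}"
    using ord v_eq[of c i] v_eq[of c j] v_eq[of d i] v_eq[of d j] by simp_all
  show False
  proof (rule crossing_chords_meet[OF \<alpha>(1) \<beta>(1) \<gamma>(1) \<delta>(1) \<alpha>(2,3) \<beta>(2,3) \<gamma>(2,3) \<delta>(2,3) cyc vc vd disj])
    \<comment> \<open>\<open>O1\<close> is the side \<open>U\<close> that holds both chords,
      \<open>O2\<close> the other one; the conditional names it without a case split.\<close>
    show "U = inside (path_image \<alpha> \<union> path_image \<beta>) \<and>
        (if U = inside (P e n) then outside (P e n) else inside (P e n)) = outside (path_image \<alpha> \<union> path_image \<beta>) \<or>
      (if U = inside (P e n) then outside (P e n) else inside (P e n)) = inside (path_image \<alpha> \<union> path_image \<beta>) \<and>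
        U = outside (path_image \<alpha> \<union> path_image \<beta>)"
      unfolding P using side by auto
  qed (use sub in auto)
qed

lemma path_connected_obtain_arc:
  fixes S :: "complex set"
  assumes "path_connected S" "x \<in> S" "y \<in> S" "x \<noteq> y"
  obtains g where "arc g" "path_image g \<subseteq> S" "pathstart g = x" "pathfinish g = y"
  using assms path_connected_arcwise by blast

lemma connected_subset_Un_disjoint_open:
  assumes "connected A" "A \<subseteq> U \<union> V" "open U" "open V" "U \<inter> V = {}"
  shows "A \<subseteq> U \<or> A \<subseteq> V"
proof -
  have "U \<inter> A = {} \<or> V \<inter> A = {}"
    using assms by (intro connectedD) auto
  then show ?thesis
    using assms(2) by blast
qed

text \<open>Edges are path-connected sets rather than arcs, since they will be glued from pieces of
  branch sets and links; an arc is chosen in each one later. \<open>D i j\<close> and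
  \<open>D j i\<close> count as the same edge and may overlap freely.\<close>

definition graph_drawing :: "nat \<Rightarrow> (nat \<Rightarrow> nat \<Rightarrow> bool) \<Rightarrow> (nat \<Rightarrow> complex) \<Rightarrow> (nat \<Rightarrow> nat \<Rightarrow> complex set) \<Rightarrow> bool" where
  "graph_drawing n R v D \<longleftrightarrow> inj_on v {..<n} \<and>
     (\<forall>i<n. \<forall>j<n. i \<noteq> j \<and> R i j \<longrightarrow> path_connected (D i j) \<and> v i \<in> D i j \<and> v j \<in> D i j) \<and>
     (\<forall>i<n. \<forall>j<n. \<forall>k<n. \<forall>l<n. i \<noteq> j \<and> R i j \<and> k \<noteq> l \<and> R k l \<and> {i, j} \<noteq> {k, l} \<longrightarrow>
        D i j \<inter> D k l \<subseteq> v ` ({i, j} \<inter> {k, l}))"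

text \<open>\<open>S i j\<close> says that the chord runs inside the Hamiltonian cycle. Interleaved
  chords on one side are excluded by \<open>polygon_chords_same_side\<close>, so the conflict
  relation between chords must be two-colorable.\<close>

lemma hamiltonian_drawing_chords:
  assumes dr: "graph_drawing n R v D"
    and ham: "\<And>k. k < n \<Longrightarrow> R k (Suc k mod n)"
  shows "\<exists>S :: nat \<Rightarrow> nat \<Rightarrow> bool. \<forall>i c j d. i < c \<and> c < j \<and> j < d \<and> d < n \<and> R i j \<and> R c d \<longrightarrow> S i j \<noteq> S c d"
proof (cases "n \<ge> 3")
  case False
  then show ?thesis by force
next
  case n3: True
  have inj: "inj_on v {..<n}"
    and D: "\<And>i j. i < n \<Longrightarrow> j < n \<Longrightarrow> i \<noteq> j \<Longrightarrow> R i j \<Longrightarrow> path_connected (D i j) \<and> v i \<in> D i j \<and> v j \<in> D i j"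
    and meet: "\<And>i j k l. i < n \<Longrightarrow> j < n \<Longrightarrow> k < n \<Longrightarrow> l < n \<Longrightarrow> i \<noteq> j \<Longrightarrow> R i j \<Longrightarrow> k \<noteq> l \<Longrightarrow> R k l \<Longrightarrow>
      {i, j} \<noteq> {k, l} \<Longrightarrow> D i j \<inter> D k l \<subseteq> v ` ({i, j} \<inter> {k, l})"
    using dr unfolding graph_drawing_def by blast+
  have "\<exists>g. arc g \<and> path_image g \<subseteq> D i j \<and> pathstart g = v i \<and> pathfinish g = v j"
    if "i < n" "j < n" "i \<noteq> j" "R i j" for i j
    using D[OF that] that inj path_connected_obtain_arc[of "D i j" "v i" "v j"] by (metis inj_onD lessThan_iff)
  then obtain g where g: "\<And>i j. i < n \<Longrightarrow> j < n \<Longrightarrow> i \<noteq> j \<Longrightarrow> R i j \<Longrightarrow>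
      arc (g i j) \<and> path_image (g i j) \<subseteq> D i j \<and> pathstart (g i j) = v i \<and> pathfinish (g i j) = v j"
    by metis
  define e where "e k = g k (Suc k mod n)" for k
  have suc: "Suc k mod n < n" "k \<noteq> Suc k mod n" "R k (Suc k mod n)" if "k < n" for k
    using that n3 ham by (auto simp: mod_Suc)
  have e: "arc (e k) \<and> pathstart (e k) = v k \<and> pathfinish (e k) = v (Suc k mod n)"
    "path_image (e k) \<subseteq> D k (Suc k mod n)" if "k < n" for k
    using g[OF that suc[OF that]] by (auto simp: e_def)
  have pair: "{k, Suc k mod n} \<noteq> {l, Suc l mod n}" if "k < n" "l < n" "k \<noteq> l" for k l
    using that n3 by (auto simp: doubleton_eq_iff mod_Suc split: if_splits)
  have em: "path_image (e k) \<inter> path_image (e l) \<subseteq> v ` ({k, Suc k mod n} \<inter> {l, Suc l mod n})"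
    if "k < n" "l < n" "k \<noteq> l" for k l
    using meet[OF that(1) suc(1)[OF that(1)] that(2) suc(1)[OF that(2)] suc(2,3)[OF that(1)] suc(2,3)[OF that(2)] pair[OF that]]
      e(2)[OF that(1)] e(2)[OF that(2)] by blast
  let ?P = "\<Union>k<n. path_image (e k)"
  have "closed ?P"
    using e by (intro closed_UN) (auto simp: closed_arc_image)
  then have op: "open (inside ?P)" "open (outside ?P)"
    by (simp_all add: open_inside open_outside)
  define S where "S i j \<longleftrightarrow> path_image (g i j) - {v i, v j} \<subseteq> inside ?P" for i j
  have S_alt: "path_image (g i j) - {v i, v j} \<subseteq> outside ?P"
    if "\<not> S i j" and ij: "i < n" "j < n" "i \<noteq> j" "R i j" and chord: "\<And>k. k < n \<Longrightarrow> {i, j} \<noteq> {k, Suc k mod n}" for i j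
  proof -
    have "connected (path_image (g i j) - {v i, v j})"
      using connected_simple_path_endless[of "g i j"] g[OF ij] arc_imp_simple_path by auto
    moreover have "path_image (g i j) - {v i, v j} \<subseteq> inside ?P \<union> outside ?P"
    proof -
      have "path_image (g i j) \<inter> path_image (e k) \<subseteq> {v i, v j}" if "k < n" for k
        using meet[OF ij(1,2) that suc(1)[OF that] ij(3,4) suc(2,3)[OF that] chord[OF that]]
          g[OF ij] e(2)[OF that] by fast
      then show ?thesis
        unfolding inside_Un_outside by blast
    qed
    ultimately have "path_image (g i j) - {v i, v j} \<subseteq> inside ?P \<or> path_image (g i j) - {v i, v j} \<subseteq> outside ?P"
      using op inside_Int_outside[of ?P] by (intro connected_subset_Un_disjoint_open)
    then show ?thesis
      using \<open>\<not> S i j\<close> unfolding S_def by satx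
  qed
  have "S i j \<noteq> S c d" if ord: "i < c" "c < j" "j < d" "d < n" and R: "R i j" "R c d" for i c j d
  proof
    assume eq: "S i j = S c d"
    \<comment> \<open>Interleaved pairs are not edges of the cycle: each pair separates the ends of
      the other along it. This is what \<open>S_alt\<close> asks for.\<close>
    have ch: "{i, j} \<noteq> {k, Suc k mod n}" "{c, d} \<noteq> {k, Suc k mod n}" if "k < n" for k
      using that ord n3 by (auto simp: doubleton_eq_iff mod_Suc split: if_splits)
    have lt: "i < n" "j < n" "c < n" "i \<noteq> j" "c \<noteq> d"
      using ord by auto
    have disj: "path_image (g i j) \<inter> path_image (g c d) = {}"
    proof -
      have "{i, j} \<inter> {c, d} = {}"
        using ord by auto
      moreover from this have "{i, j} \<noteq> {c, d}"
        by blast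
      ultimately have "D i j \<inter> D c d \<subseteq> {}"
        using meet[OF lt(1,2,3) ord(4) lt(4) R(1) lt(5) R(2)] by simp
      then show ?thesis
        using g[OF lt(1,2,4) R(1)] g[OF lt(3) ord(4) lt(5) R(2)] by blast
    qed
    define U where "U = (if S i j then inside ?P else outside ?P)"
    have "path_image (g i j) - {v i, v j} \<subseteq> U"
      using S_alt[OF _ lt(1,2,4) R(1) ch(1)] S_def[of i j] unfolding U_def by (cases "S i j") auto
    moreover have "path_image (g c d) - {v c, v d} \<subseteq> U"
      using S_alt[OF _ lt(3) ord(4) lt(5) R(2) ch(2)] S_def[of c d] unfolding U_def eq by (cases "S c d") auto
    moreover have "U = inside ?P \<or> U = outside ?P"
      by (simp add: U_def)
    ultimately show False
      using g[OF lt(1,2,4) R(1)] g[OF lt(3) ord(4) lt(5) R(2)]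
      by (intro polygon_chords_same_side[OF inj e(1) em ord _ _ _ _ _ _ disj]) simp_all
  qed
  then show ?thesis
    by blast
qed

text \<open>The parts are the even and the odd indices, so \<open>0, ..., 5\<close> is a Hamiltonian
  cycle. Its three long diagonals interleave pairwise: a triangle of conflicts between only two
  sides.\<close>

lemma no_drawing_K33: "\<not> graph_drawing 6 (\<lambda>i j. odd (i + j)) v D"
proof
  assume dr: "graph_drawing 6 (\<lambda>i j. odd (i + j)) v D"
  have odd_ham: "odd (k + Suc k mod 6)" if "k < 6" for k :: nat
    using that by (cases "k = 5") simp_all
  have "\<exists>S :: nat \<Rightarrow> nat \<Rightarrow> bool. \<forall>i c j d. i < c \<and> c < j \<and> j < d \<and> d < 6 \<and> odd (i + j) \<and> odd (c + d) \<longrightarrow> S i j \<noteq> S c d"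
    by (rule hamiltonian_drawing_chords[OF dr]) (rule odd_ham)
  then obtain S :: "nat \<Rightarrow> nat \<Rightarrow> bool" where
    S: "\<forall>i c j d. i < c \<and> c < j \<and> j < d \<and> d < 6 \<and> odd (i + j) \<and> odd (c + d) \<longrightarrow> S i j \<noteq> S c d"
    by (rule exE)
  have "S 0 3 \<noteq> S 1 4" "S 0 3 \<noteq> S 2 5" "S 1 4 \<noteq> S 2 5"
    by (rule S[rule_format]; simp)+
  then show False
    by satx
qed

text \<open>Two diagonals of a pentagon interleave unless they share an end, so the five conflicts
  form a cycle of odd length.\<close>

lemma no_drawing_K5: "\<not> graph_drawing 5 (\<lambda>i j. True) v D"
proof
  assume dr: "graph_drawing 5 (\<lambda>i j. True) v D"
  have "\<exists>S :: nat \<Rightarrow> nat \<Rightarrow> bool. \<forall>i c j d. i < c \<and> c < j \<and> j < d \<and> d < 5 \<longrightarrow> S i j \<noteq> S c d"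
    using hamiltonian_drawing_chords[OF dr] by simp
  then obtain S :: "nat \<Rightarrow> nat \<Rightarrow> bool" where
    S: "\<forall>i c j d. i < c \<and> c < j \<and> j < d \<and> d < 5 \<longrightarrow> S i j \<noteq> S c d"
    by (rule exE)
  have "S 0 2 \<noteq> S 1 3" "S 1 3 \<noteq> S 2 4" "S 0 3 \<noteq> S 2 4" "S 0 3 \<noteq> S 1 4" "S 0 2 \<noteq> S 1 4"
    by (rule S[rule_format]; simp)+
  then show False
    by satx
qed

section \<open>Fat drawings\<close>

text \<open>
  A minor model in the plane: \<open>C i\<close> is the branch set of \<open>i\<close>, and \<open>e i j\<close> is a link that reaches
  \<open>C i\<close> only at the terminal \<open>t i j\<close>. Links may meet inside a common branch set, because the two ends
  of the bridge in \<open>splits_at\<close> may themselves be terminals.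
\<close>

definition fat_drawing :: "nat \<Rightarrow> (nat \<Rightarrow> nat \<Rightarrow> bool) \<Rightarrow> (nat \<Rightarrow> complex set) \<Rightarrow> (nat \<Rightarrow> nat \<Rightarrow> complex set)
    \<Rightarrow> (nat \<Rightarrow> nat \<Rightarrow> complex) \<Rightarrow> bool" where
  "fat_drawing n R C e t \<longleftrightarrow>
     (\<forall>i<n. path_connected (C i)) \<and>
     (\<forall>i<n. \<forall>j<n. i \<noteq> j \<longrightarrow> C i \<inter> C j = {}) \<and>
     (\<forall>i<n. \<forall>j<n. i \<noteq> j \<and> R i j \<longrightarrow> path_connected (e i j) \<and> R j i \<and> e i j = e j i \<and> e i j \<inter> C i = {t i j} \<and>
        (\<forall>k<n. k \<noteq> i \<and> k \<noteq> j \<longrightarrow> e i j \<inter> C k = {})) \<and>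
     (\<forall>i<n. \<forall>j<n. \<forall>k<n. \<forall>l<n. i \<noteq> j \<and> R i j \<and> k \<noteq> l \<and> R k l \<and> {i, j} \<noteq> {k, l} \<longrightarrow>
        e i j \<inter> e k l \<subseteq> (\<Union>x\<in>{i, j} \<inter> {k, l}. C x))"

text \<open>Legs may be degenerate: \<open>S j\<close> can be \<open>{x}\<close> if the terminal
  \<open>t j\<close> is the center itself. This matters because several terminals may
  coincide.\<close>

definition star_at :: "complex set \<Rightarrow> nat set \<Rightarrow> (nat \<Rightarrow> complex) \<Rightarrow> complex \<Rightarrow> (nat \<Rightarrow> complex set) \<Rightarrow> bool" where
  "star_at C J t x S \<longleftrightarrow> x \<in> C \<and>
     (\<forall>j\<in>J. path_connected (S j) \<and> S j \<subseteq> C \<and> x \<in> S j \<and> t j \<in> S j) \<and>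
     (\<forall>j\<in>J. \<forall>k\<in>J. j \<noteq> k \<longrightarrow> S j \<inter> S k \<subseteq> {x})"

text \<open>An edge consists of a leg, a link and a leg. If two edges share a branch set, a common
  point in it that belongs to a link is a terminal which also lies on a second leg
  (\<open>t_meet\<close>), and two legs meet only in the center.\<close>

lemma stars_imp_graph_drawing:
  assumes fd: "fat_drawing n R C e t"
    and st: "\<And>i. i < n \<Longrightarrow> star_at (C i) {j. j < n \<and> j \<noteq> i \<and> R i j} (t i) (v i) (S i)"
  shows "graph_drawing n R v (\<lambda>i j. S i j \<union> e i j \<union> S j i)"
proof -
  have C: "\<And>i j. i < n \<Longrightarrow> j < n \<Longrightarrow> i \<noteq> j \<Longrightarrow> C i \<inter> C j = {}"
    using fd by (simp add: fat_drawing_def)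
  have e: "path_connected (e i j)" "R j i" "e i j = e j i" "e i j \<inter> C i = {t i j}"
    "\<And>k. k < n \<Longrightarrow> k \<noteq> i \<Longrightarrow> k \<noteq> j \<Longrightarrow> e i j \<inter> C k = {}"
    if "i < n" "j < n" "i \<noteq> j" "R i j" for i j
    using fd that by (simp_all add: fat_drawing_def)
  have ee: "e i j \<inter> e k l \<subseteq> (\<Union>x\<in>{i, j} \<inter> {k, l}. C x)"
    if "i < n" "j < n" "i \<noteq> j" "R i j" "k < n" "l < n" "k \<noteq> l" "R k l" "{i, j} \<noteq> {k, l}" for i j k l
    using fd that by (simp add: fat_drawing_def)
  have S: "path_connected (S i j)" "S i j \<subseteq> C i" "v i \<in> S i j" "t i j \<in> S i j"
    if "i < n" "j < n" "i \<noteq> j" "R i j" for i j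
    using st[OF that(1)] that unfolding star_at_def by auto
  have SS': "S i j \<inter> S i k \<subseteq> {v i}" if "i < n" "j < n" "i \<noteq> j" "R i j" "k < n" "i \<noteq> k" "R i k" "j \<noteq> k" for i j k
    using st[OF that(1)] that unfolding star_at_def by auto
  have vC: "v i \<in> C i" if "i < n" for i
    using st[OF that] by (simp add: star_at_def)
  have SS: "S i j \<inter> S k l \<subseteq> v ` ({i, j} \<inter> {k, l})"
    if ij: "i < n" "j < n" "i \<noteq> j" "R i j" and kl: "k < n" "l < n" "k \<noteq> l" "R k l" and ne: "{i, j} \<noteq> {k, l}" for i j k l
  proof (cases "i = k")
    case True
    then have "j \<noteq> l"
      using ne by auto
    then show ?thesis
      using SS'[OF ij kl(2)] kl True by auto
  next
    case False
    then show ?thesis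
      using S(2)[OF ij] S(2)[OF kl] C[OF ij(1) kl(1)] by blast
  qed
  have t_meet: "t i j = v i" if "i < n" "j < n" "i \<noteq> j" "R i j" "k < n" "i \<noteq> k" "R i k" "j \<noteq> k" "t i j \<in> S i k" for i j k
    using SS'[of i j k] S(4)[of i j] that by blast
  have Se1: "S k j \<inter> e k l \<subseteq> {v k}"
    if "k < n" "j < n" "k \<noteq> j" "R k j" "l < n" "k \<noteq> l" "R k l" "j \<noteq> l" for k j l
  proof
    fix z assume z: "z \<in> S k j \<inter> e k l"
    then have "z = t k l"
      using e(4)[of k l] S(2)[of k j] that by blast
    then show "z \<in> {v k}"
      using t_meet[of k l j] that z by simp
  qed
  have Se: "S i j \<inter> e k l \<subseteq> v ` ({i, j} \<inter> {k, l})"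
    if ij: "i < n" "j < n" "i \<noteq> j" "R i j" and kl: "k < n" "l < n" "k \<noteq> l" "R k l" and ne: "{i, j} \<noteq> {k, l}" for i j k l
  proof -
    consider "i = k" | "i = l" | "i \<noteq> k" "i \<noteq> l" by blast
    then show ?thesis
    proof cases
      case 1
      then have "j \<noteq> l" using ne by auto
      then show ?thesis
        using Se1[of k j l] 1 ij kl by auto
    next
      case 2
      then have "j \<noteq> k" using ne by auto
      then show ?thesis
        using Se1[of l j k] 2 ij kl e(2,3)[OF kl] by auto
    next
      case 3
      then show ?thesis
        using e(5)[OF kl ij(1)] S(2)[OF ij] by blast
    qed
  qed
  have ee1: "e i j \<inter> e i l \<inter> C i \<subseteq> {v i}"
    if "i < n" "j < n" "i \<noteq> j" "R i j" "l < n" "i \<noteq> l" "R i l" "j \<noteq> l" for i j l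
  proof -
    have "e i j \<inter> e i l \<inter> C i = {t i j} \<inter> {t i l}"
      using e(4)[of i j] e(4)[of i l] that by blast
    then show ?thesis
      using t_meet[of i j l] S(4)[of i l] that by auto
  qed
  have EE: "e i j \<inter> e k l \<subseteq> v ` ({i, j} \<inter> {k, l})"
    if ij: "i < n" "j < n" "i \<noteq> j" "R i j" and kl: "k < n" "l < n" "k \<noteq> l" "R k l" and ne: "{i, j} \<noteq> {k, l}" for i j k l
  proof
    fix z assume z: "z \<in> e i j \<inter> e k l"
    then obtain x where x: "x \<in> {i, j}" "x \<in> {k, l}" "z \<in> C x"
      using ee[OF ij kl ne] by blast
    obtain y where y: "{i, j} = {x, y}" "x \<noteq> y" "y < n" "R x y" "e i j = e x y"
      using x(1) ij e(2,3)[OF ij] by (cases "x = i") (auto simp: insert_commute)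
    obtain w where w: "{k, l} = {x, w}" "x \<noteq> w" "w < n" "R x w" "e k l = e x w"
      using x(2) kl e(2,3)[OF kl] by (cases "x = k") (auto simp: insert_commute)
    have "x < n"
      using x(1) ij(1,2) by blast
    have "y \<noteq> w"
      using ne y(1) w(1) by metis
    have "z \<in> e x y \<inter> e x w \<inter> C x"
      using z x(3) unfolding y(5) w(5) by blast
    then have "z = v x"
      using ee1[OF \<open>x < n\<close> y(3,2,4) w(3,2,4) \<open>y \<noteq> w\<close>] by blast
    then show "z \<in> v ` ({i, j} \<inter> {k, l})"
      using x by blast
  qed
  show ?thesis
    unfolding graph_drawing_def
  proof (intro conjI allI impI, goal_cases)
    case 1
    show ?case
      using C vC by (metis disjoint_iff inj_onI lessThan_iff)
  next
    case (2 i j)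
    then have ij: "i < n" "j < n" "i \<noteq> j" "R i j" and ji: "j < n" "i < n" "j \<noteq> i" "R j i"
      using e(2)[of i j] by auto
    have "path_connected (S i j \<union> e i j)"
      using S[OF ij] e[OF ij] by (intro path_connected_Un) auto
    moreover have "t j i \<in> e i j"
      using e(3)[OF ij] e(4)[OF ji] by blast
    ultimately show ?case
      using path_connected_Un[OF _ S(1)[OF ji]] S(4)[OF ji] by blast
  next
    case (3 i j)
    then show ?case using S(3)[of i j] by auto
  next
    case (4 i j)
    then show ?case using S(3)[of j i] e(2)[of i j] by auto
  next
    case (5 i j k l)
    then have ij: "i < n" "j < n" "i \<noteq> j" "R i j" and ji: "j < n" "i < n" "j \<noteq> i" "R j i"
      and kl: "k < n" "l < n" "k \<noteq> l" "R k l" and lk: "l < n" "k < n" "l \<noteq> k" "R l k"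
      and ne: "{i, j} \<noteq> {k, l}"
      using e(2)[of i j] e(2)[of k l] by auto
    have ne': "{j, i} \<noteq> {k, l}" "{i, j} \<noteq> {l, k}" "{j, i} \<noteq> {l, k}" "{k, l} \<noteq> {i, j}" "{l, k} \<noteq> {i, j}"
      using ne by (metis insert_commute)+
    let ?V = "v ` ({i, j} \<inter> {k, l})"
    have "S i j \<inter> S k l \<subseteq> ?V" "S j i \<inter> S k l \<subseteq> ?V" "S i j \<inter> S l k \<subseteq> ?V" "S j i \<inter> S l k \<subseteq> ?V"
      using SS[OF ij kl ne] SS[OF ji kl ne'(1)] SS[OF ij lk ne'(2)] SS[OF ji lk ne'(3)]
      by (simp_all only: insert_commute)
    moreover have "S i j \<inter> e k l \<subseteq> ?V" "S j i \<inter> e k l \<subseteq> ?V"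
      using Se[OF ij kl ne] Se[OF ji kl ne'(1)] by (simp_all only: insert_commute)
    moreover have "e i j \<inter> S k l \<subseteq> ?V" "e i j \<inter> S l k \<subseteq> ?V"
      using Se[OF kl ij ne'(4)] Se[OF lk ij ne'(5)] by (simp_all only: insert_commute Int_commute)
    ultimately show ?case
      using EE[OF ij kl ne] by (simp only: Int_Un_distrib Int_Un_distrib2 Un_subset_iff simp_thms)
  qed
qed

section \<open>Trees joining three or four terminals inside a branch set\<close>

lemma path_connected_subarc:
  assumes "path g" "0 \<le> a" "b \<le> 1"
  shows "path_connected (g ` {a..b})"
  using assms by (intro path_connected_continuous_image convex_imp_path_connected)
    (auto intro: continuous_on_subset simp: path_def)

text \<open>Stop a path into \<open>T\<close> where it first reaches \<open>T\<close>, then pick an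
  arc inside the image of the truncated path; closedness of \<open>T\<close> puts the stopping point
  into \<open>T\<close>.\<close>

lemma obtain_arc_to_closed:
  fixes C :: "complex set"
  assumes C: "path_connected C" and T: "closed T" "T \<subseteq> C" "T \<noteq> {}" and x: "x \<in> C - T"
  obtains q where "arc q" "pathstart q = x" "path_image q \<subseteq> C" "path_image q \<inter> T = {pathfinish q}"
proof -
  obtain y where y: "y \<in> T"
    using T by blast
  have "x \<in> C" "y \<in> C" "x \<noteq> y"
    using T(2) x y by auto
  then obtain g where g: "arc g" "path_image g \<subseteq> C" "pathstart g = x" "pathfinish g = y"
    by (rule path_connected_obtain_arc[OF C])
  have "x \<in> closure (- T)"
    using x closure_subset by blast
  then obtain h where h: "path h" "pathstart h = x" "path_image h \<subseteq> path_image g"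
      "path_image h - {pathfinish h} \<subseteq> interior (- T)" "pathfinish h \<in> frontier (- T)"
    using exists_path_subpath_to_frontier[of g "- T"] g y arc_imp_path by (metis ComplD)
  have "pathfinish h \<in> T"
    using h(5) T(1) frontier_subset_eq[of T] unfolding frontier_complement by blast
  moreover from this have "x \<noteq> pathfinish h"
    using x by blast
  ultimately obtain q where q: "arc q" "path_image q \<subseteq> path_image h" "pathstart q = x" "pathfinish q = pathfinish h"
    using path_connected_obtain_arc[OF path_connected_path_image[OF h(1)], of x "pathfinish h"] h(2)
    by (metis pathfinish_in_path_image pathstart_in_path_image)
  have "path_image q - {pathfinish q} \<subseteq> - T"
  proof -
    have "path_image q - {pathfinish q} \<subseteq> path_image h - {pathfinish h}"
      using q(2) unfolding q(4) by (rule Diff_mono) simp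
    also have "\<dots> \<subseteq> - T"
      using h(4) interior_subset[of "- T"] by (rule subset_trans)
    finally show ?thesis .
  qed
  moreover have "pathfinish q \<in> path_image q \<inter> T"
    using \<open>pathfinish h \<in> T\<close> q(4) pathfinish_in_path_image[of q] by simp
  ultimately have "path_image q \<inter> T = {pathfinish q}"
    by blast
  moreover have "path_image q \<subseteq> C"
    using q(2) h(3) g(2) by (meson subset_trans)
  ultimately show ?thesis
    using that[OF q(1,3)] by simp
qed

lemma obtain_link_to_closed:
  fixes C :: "complex set"
  assumes C: "path_connected C" and T: "closed T" "T \<subseteq> C" "T \<noteq> {}" and x: "x \<in> C"
  obtains Q y where "path_connected Q" "closed Q" "Q \<subseteq> C" "x \<in> Q" "Q \<inter> T = {y}"
proof (cases "x \<in> T")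
  case True
  then show ?thesis
    using that[of "{x}" x] x by auto
next
  case False
  with obtain_arc_to_closed[OF C T, of x] x obtain q where "arc q" "pathstart q = x" "path_image q \<subseteq> C" "path_image q \<inter> T = {pathfinish q}"
    by blast
  then show ?thesis
    using that[of "path_image q"] by (metis arc_imp_path closed_arc_image path_connected_path_image pathstart_in_path_image)
qed

lemma path_image_arc_split:
  assumes "arc p" "s \<in> {0..1}"
  shows "p ` {0..s} \<inter> p ` {s..1} = {p s}" "p ` {0..s} \<union> p ` {s..1} = path_image p"
proof -
  have inj: "inj_on p {0..1}"
    using assms by (simp add: arc_def)
  have "p ` {0..s} \<inter> p ` {s..1} = p ` ({0..s} \<inter> {s..1})"
    using assms by (intro inj_on_image_Int[OF inj, symmetric]) auto
  also have "{0..s} \<inter> {s..1} = {s}"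
    using assms by auto
  finally show "p ` {0..s} \<inter> p ` {s..1} = {p s}"
    by simp
  have "{0..s} \<union> {s..1} = {0..1}"
    using assms by auto
  then show "p ` {0..s} \<union> p ` {s..1} = path_image p"
    unfolding path_image_def image_Un[symmetric] by simp
qed

text \<open>Join two terminals by an arc and link the third one to it; the landing point is the
  center.\<close>

lemma obtain_star3:
  assumes C: "path_connected C" and J: "J = {a, b, c}" "a \<noteq> b" "a \<noteq> c" "b \<noteq> c" and t: "\<And>j. j \<in> J \<Longrightarrow> t j \<in> C"
  shows "\<exists>x S. star_at C J t x S"
proof (cases "t a = t b")
  case True
  \<comment> \<open>With two equal terminals no arc between them exists, but their common point is a
    center with two degenerate legs, and the whole of \<open>C\<close> serves as the third.\<close>
  then have "star_at C J t (t a) (\<lambda>j. if j = c then C else {t a})"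
    using J t C unfolding star_at_def by auto
  then show ?thesis by blast
next
  case False
  have "t a \<in> C" "t b \<in> C"
    using t J(1) by auto
  then obtain p where p: "arc p" "path_image p \<subseteq> C" "pathstart p = t a" "pathfinish p = t b"
    using False by (rule path_connected_obtain_arc[OF C])
  obtain Q y where Q: "path_connected Q" "Q \<subseteq> C" "t c \<in> Q" "Q \<inter> path_image p = {y}"
    using obtain_link_to_closed[OF C closed_arc_image[OF p(1)] p(2), of "t c"] t J by (metis insertCI path_image_nonempty)
  then obtain s where s: "s \<in> {0..1}" "y = p s"
    unfolding path_image_def by blast
  note sp = path_image_arc_split[OF p(1) s(1)]
  define A B where "A = p ` {0..s}" and "B = p ` {s..1}"
  have AB: "path_connected A" "path_connected B"
    using path_connected_subarc[OF arc_imp_path[OF p(1)]] s(1) by (simp_all add: A_def B_def)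
  have AB': "A \<subseteq> C" "B \<subseteq> C" "A \<inter> B = {y}" "y \<in> A" "y \<in> B" "A \<inter> Q \<subseteq> {y}" "B \<inter> Q \<subseteq> {y}"
    using sp p(2) s Q(4) by (auto simp: A_def B_def)
  have ends: "t a \<in> A" "t b \<in> B"
    using p(3,4) s(1) imageI[of 0 "{0..s}" p] imageI[of 1 "{s..1}" p]
    by (simp_all add: A_def B_def pathstart_def pathfinish_def)
  have y: "y \<in> C" "y \<in> Q"
    using Q by blast+
  have "star_at C J t y (\<lambda>j. if j = a then A else if j = b then B else Q)"
    unfolding star_at_def J(1) using J(2-4) AB AB' ends y Q(1-3) by (simp add: Int_commute)
  then show ?thesis by blast
qed

text \<open>The H-shape: the two pairs of terminals lie in disjoint pieces joined by the bridge \<open>f\<close>.\<close>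

definition splits_at :: "complex set \<Rightarrow> nat set \<Rightarrow> (nat \<Rightarrow> complex) \<Rightarrow> bool" where
  "splits_at C J t \<longleftrightarrow> (\<exists>a b c d P1 P2 f s1 s2. J = {a, b, c, d} \<and> distinct [a, b, c, d] \<and>
     path_connected P1 \<and> path_connected P2 \<and> path_connected f \<and> P1 \<subseteq> C \<and> P2 \<subseteq> C \<and> f \<subseteq> C \<and>
     P1 \<inter> P2 = {} \<and> t a \<in> P1 \<and> t b \<in> P1 \<and> t c \<in> P2 \<and> t d \<in> P2 \<and> f \<inter> P1 = {s1} \<and> f \<inter> P2 = {s2})"

lemma splits_atI:
  assumes "J = {a, b, c, d}" "distinct [a, b, c, d]" "path_connected P1" "path_connected P2" "path_connected f"
    "P1 \<subseteq> C" "P2 \<subseteq> C" "f \<subseteq> C" "P1 \<inter> P2 = {}" "t a \<in> P1" "t b \<in> P1" "t c \<in> P2" "t d \<in> P2"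
    "f \<inter> P1 = {s1}" "f \<inter> P2 = {s2}"
  shows "splits_at C J t"
  unfolding splits_at_def
  by (rule exI[of _ a], rule exI[of _ b], rule exI[of _ c], rule exI[of _ d], rule exI[of _ P1],
      rule exI[of _ P2], rule exI[of _ f], rule exI[of _ s1], rule exI[of _ s2], intro conjI; fact assms)

lemma Int_eq_of_subset:
  assumes "Q \<inter> P = {y}" "f \<subseteq> P"
  shows "f \<inter> Q = (if y \<in> f then {y} else {})"
  using assms by auto

text \<open>The links land at different points of \<open>p\<close>. The stretch of \<open>p\<close>
  between them is the bridge, and each outer stretch with its link is a piece of the H, so that
  \<open>a\<close> is paired with \<open>c\<close> and \<open>b\<close> with
  \<open>d\<close>.\<close>

lemma splits_at_two_links:
  assumes J: "J = {a, b, c, d}" "distinct [a, b, c, d]"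
    and p: "arc p" "path_image p \<subseteq> C" "pathstart p = t a" "pathfinish p = t b"
    and Q: "path_connected Q" "Q \<subseteq> C" "t c \<in> Q" "Q \<inter> path_image p = {p u}"
    and Q': "path_connected Q'" "Q' \<subseteq> C" "t d \<in> Q'" "Q' \<inter> path_image p = {p v}"
    and disj: "Q \<inter> Q' = {}"
    and uv: "0 \<le> u" "u < v" "v \<le> 1"
  shows "splits_at C J t"
proof -
  define A B f where "A = p ` {0..u}" and "B = p ` {v..1}" and "f = p ` {u..v}"
  have inj: "inj_on p {0..1}"
    using p by (simp add: arc_def)
  have pc: "path_connected A" "path_connected B" "path_connected f"
    using path_connected_subarc[OF arc_imp_path[OF p(1)]] uv by (simp_all add: A_def B_def f_def)
  have sub: "A \<subseteq> path_image p" "B \<subseteq> path_image p" "f \<subseteq> path_image p"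
    using uv by (auto simp: A_def B_def f_def path_image_def)
  have inA: "p u \<in> A" "p v \<in> B" "p u \<in> f" "p v \<in> f" "t a \<in> A" "t b \<in> B"
    using uv p(3,4) imageI[of 0 "{0..u}" p] imageI[of 1 "{v..1}" p]
    by (simp_all add: A_def B_def f_def pathstart_def pathfinish_def)
  have int: "p ` X \<inter> p ` Y = p ` (X \<inter> Y)" if "X \<subseteq> {0..1}" "Y \<subseteq> {0..1}" for X Y
    using inj_on_image_Int[OF inj that] by simp
  have "A \<inter> B = p ` ({0..u} \<inter> {v..1})" "f \<inter> A = p ` ({u..v} \<inter> {0..u})" "f \<inter> B = p ` ({u..v} \<inter> {v..1})"
    unfolding A_def B_def f_def using uv by (intro int; simp)+
  moreover have "{0..u} \<inter> {v..1} = {}" "{u..v} \<inter> {0..u} = {u}" "{u..v} \<inter> {v..1} = {v}"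
    using uv by auto
  ultimately have AB: "A \<inter> B = {}" "f \<inter> A = {p u}" "f \<inter> B = {p v}"
    by simp_all
  have pu: "p u \<in> Q" "p v \<in> Q'"
    using Q(4) Q'(4) by blast+
  have "p u \<noteq> p v"
    using inj uv by (auto dest: inj_onD)
  have pc2: "path_connected (A \<union> Q)" "path_connected (B \<union> Q')"
    using pc Q(1) Q'(1) inA pu by (auto intro!: path_connected_Un)
  have "p u \<notin> B" "p v \<notin> A"
    using inA AB(1) by blast+
  then have BQ: "B \<inter> Q = {}" "A \<inter> Q' = {}" and fQ: "f \<inter> Q = {p u}" "f \<inter> Q' = {p v}"
    using Int_eq_of_subset[OF Q(4) sub(2)] Int_eq_of_subset[OF Q'(4) sub(1)]
      Int_eq_of_subset[OF Q(4) sub(3)] Int_eq_of_subset[OF Q'(4) sub(3)] inA by simp_all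
  show ?thesis
  proof (rule splits_atI[OF _ _ pc2 pc(3)])
    show "J = {a, c, b, d}" "distinct [a, c, b, d]"
      using J by auto
    show "(A \<union> Q) \<inter> (B \<union> Q') = {}"
      using AB(1) BQ disj by (simp add: Int_Un_distrib Int_Un_distrib2 Int_commute)
    show "f \<inter> (A \<union> Q) = {p u}" "f \<inter> (B \<union> Q') = {p v}"
      using AB(2,3) fQ by (simp_all add: Int_Un_distrib)
  qed (use sub p(2) Q(2,3) Q'(2,3) inA in \<open>auto\<close>)
qed

text \<open>Join \<open>t a\<close> to \<open>t b\<close> by an arc \<open>p\<close>, link
  \<open>t c\<close> to \<open>p\<close> by \<open>Q\<close>, and link \<open>t d\<close> to the
  union by \<open>Q'\<close>. If both links land at the same point of \<open>p\<close>, there is a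
  star. If they land at different points of \<open>p\<close>, the bridge is a stretch of
  \<open>p\<close>; if \<open>Q'\<close> lands on \<open>Q\<close> away from \<open>p\<close>, the
  bridge is a stretch of \<open>Q\<close>.\<close>

lemma star4_or_splits:
  assumes C: "path_connected C" and J: "J = {a, b, c, d}" "distinct [a, b, c, d]"
    and t: "t ` J \<subseteq> C" and ab: "t a \<noteq> t b"
  shows "(\<exists>x S. star_at C J t x S) \<or> splits_at C J t"
proof -
  have tC: "t a \<in> C" "t b \<in> C" "t c \<in> C" "t d \<in> C"
    using t J by auto
  obtain p where p: "arc p" "path_image p \<subseteq> C" "pathstart p = t a" "pathfinish p = t b"
    by (rule path_connected_obtain_arc[OF C tC(1,2) ab])
  let ?P = "path_image p"
  have inj: "inj_on p {0..1}"
    using p by (simp add: arc_def)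
  have clP: "closed ?P" "?P \<noteq> {}"
    using closed_arc_image[OF p(1)] by simp_all
  \<comment> \<open>\<open>Qarc\<close> is recorded because the last case cuts \<open>Q\<close> at
    the point where \<open>Q'\<close> arrives.\<close>
  obtain Q y where Q: "path_connected Q" "closed Q" "Q \<subseteq> C" "t c \<in> Q" "Q \<inter> ?P = {y}"
    and Qarc: "Q = {y} \<or> (\<exists>q. arc q \<and> pathstart q = t c \<and> pathfinish q = y \<and> path_image q = Q)"
  proof (cases "t c \<in> ?P")
    case True
    then show ?thesis
      using that[of "{t c}" "t c"] tC by auto
  next
    case False
    then obtain q where "arc q" "pathstart q = t c" "path_image q \<subseteq> C" "path_image q \<inter> ?P = {pathfinish q}"
      using obtain_arc_to_closed[OF C clP(1) p(2) clP(2), of "t c"] tC by blast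
    then show ?thesis
      using that[of "path_image q" "pathfinish q"] 
      by (metis arc_imp_path closed_arc_image path_connected_path_image pathstart_in_path_image)
  qed
  obtain Q' y' where Q': "path_connected Q'" "Q' \<subseteq> C" "t d \<in> Q'" "Q' \<inter> (?P \<union> Q) = {y'}"
    using obtain_link_to_closed[OF C closed_Un[OF clP(1) Q(2)], of "t d"] p(2) Q(3) tC clP(2)
    by (metis Un_empty Un_subset_iff)
  show ?thesis
  proof (cases "y' \<in> ?P")
    case True
    then have Q'P: "Q' \<inter> ?P = {y'}" and QQ': "Q \<inter> Q' \<subseteq> {y'}"
      using Q'(4) by blast+
    obtain u where u: "u \<in> {0..1}" "y = p u"
      using Q(5) unfolding path_image_def by blast
    obtain v where v: "v \<in> {0..1}" "y' = p v"
      using True unfolding path_image_def by blast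
    have disj: "Q \<inter> Q' = {}" if "u \<noteq> v"
    proof -
      have "y \<noteq> y'"
        using u v inj that by (auto dest: inj_onD)
      then show ?thesis
        using QQ' Q(5) True by blast
    qed
    consider "u = v" | "u < v" | "v < u"
      by linarith
    then show ?thesis
    proof cases
      case 1
      then have yy: "y' = y"
        using u v by simp
      note sp = path_image_arc_split[OF p(1) u(1)]
      define A B where "A = p ` {0..u}" and "B = p ` {u..1}"
      have AB: "path_connected A" "path_connected B"
        using path_connected_subarc[OF arc_imp_path[OF p(1)]] u(1) by (simp_all add: A_def B_def)
      have AP: "A \<subseteq> ?P" "B \<subseteq> ?P" "A \<inter> B = {y}"
        using sp unfolding A_def[symmetric] B_def[symmetric] u(2)[symmetric] by auto
      then have AB': "A \<subseteq> C" "B \<subseteq> C" "y \<in> A" "y \<in> B"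
        using p(2) by auto
      then have "A \<inter> Q \<subseteq> {y}" "B \<inter> Q \<subseteq> {y}" "A \<inter> Q' \<subseteq> {y}" "B \<inter> Q' \<subseteq> {y}"
        using Int_eq_of_subset[OF Q(5) AP(1)] Int_eq_of_subset[OF Q(5) AP(2)]
          Int_eq_of_subset[OF Q'P AP(1)] Int_eq_of_subset[OF Q'P AP(2)] unfolding yy by simp_all
      note AB' = AB' this
      have ends: "t a \<in> A" "t b \<in> B"
        using p(3,4) u(1) imageI[of 0 "{0..u}" p] imageI[of 1 "{u..1}" p]
        by (simp_all add: A_def B_def pathstart_def pathfinish_def)
      have y: "y \<in> C" "y \<in> Q" "y \<in> Q'"
        using Q Q'P yy by blast+
      have "star_at C J t y (\<lambda>j. if j = a then A else if j = b then B else if j = c then Q else Q')"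
        unfolding star_at_def J(1) using J(2) AB AP(3) AB' ends y Q(1,3,4) Q'(1-3) QQ' yy by (simp add: Int_commute) 
      then show ?thesis by blast
    next
      case 2
      then have "splits_at C J t"
        using u(1) v(1)
        by (intro splits_at_two_links[OF J p Q(1,3,4) Q(5)[unfolded u(2)] Q'(1-3) Q'P[unfolded v(2)] disj]) simp_all
      then show ?thesis ..
    next
      case 3
      have J': "J = {a, b, d, c}" "distinct [a, b, d, c]"
        using J by auto
      have "Q' \<inter> Q = {}"
        using disj 3 by (simp add: Int_commute)
      from splits_at_two_links[OF J' p Q'(1-3) Q'P[unfolded v(2)] Q(1,3,4) Q(5)[unfolded u(2)] this]
      have "splits_at C J t"
        using 3 u(1) v(1) by simp
      then show ?thesis ..
    qed
  next
    case False
    have "y' \<in> Q' \<inter> (?P \<union> Q)"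
      by (simp add: Q'(4))
    then have y': "y' \<in> Q" "Q' \<inter> ?P = {}"
      using Int_eq_of_subset[OF Q'(4), of ?P] False by (simp_all add: Int_commute)
    have "Q \<noteq> {y}"
    proof
      assume "Q = {y}"
      then have "y' = y"
        using y'(1) by simp
      moreover have "y \<in> Q \<inter> ?P"
        by (simp add: Q(5))
      ultimately show False
        using False by simp
    qed
    then obtain q where q: "arc q" "pathstart q = t c" "pathfinish q = y" "path_image q = Q"
      using Qarc by blast
    obtain s where s: "s \<in> {0..1}" "y' = q s"
      using y'(1) q(4) unfolding path_image_def by blast
    \<comment> \<open>\<open>A\<close> leads from \<open>t c\<close> to the landing point of
      \<open>Q'\<close> and forms one piece with \<open>Q'\<close>; the rest \<open>f\<close> of
      \<open>Q\<close> is the bridge to the other piece \<open>p\<close>.\<close>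
    define A f where "A = q ` {0..s}" and "f = q ` {s..1}"
    have pc: "path_connected A" "path_connected f"
      using path_connected_subarc[OF arc_imp_path[OF q(1)]] s(1) by (simp_all add: A_def f_def)
    note sp = path_image_arc_split[OF q(1) s(1), folded A_def f_def, unfolded q(4), folded s(2)]
    have inA: "y' \<in> A" "t c \<in> A" "y \<in> f" "y' \<in> f"
    proof -
      have "q 0 \<in> A" "q s \<in> A" "q 1 \<in> f" "q s \<in> f"
        unfolding A_def f_def using s(1) by (intro imageI; simp)+
      then show "y' \<in> A" "t c \<in> A" "y \<in> f" "y' \<in> f"
        using s(2) q(2,3) by (simp_all add: pathstart_def pathfinish_def)
    qed
    have "y \<noteq> y'"
    proof -
      have "y \<in> Q \<inter> ?P"
        by (simp add: Q(5))
      then show ?thesis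
        using False by auto
    qed
    moreover have "y' \<in> A \<inter> f"
      using inA by blast
    ultimately have "y \<notin> A"
      using sp(1) inA(3) by blast
    moreover have sub: "A \<subseteq> Q" "f \<subseteq> Q"
      using sp(2) by blast+
    ultimately have "A \<inter> ?P = {}" "f \<inter> ?P = {y}"
      using Int_eq_of_subset[of ?P Q y A] Int_eq_of_subset[of ?P Q y f] Q(5) inA(3) by (simp_all add: Int_commute)
    moreover have "f \<inter> Q' = {y'}"
      using Int_eq_of_subset[of Q' "?P \<union> Q" y' f] Q'(4) sub(2) inA(4) by auto
    ultimately have meets: "?P \<inter> (A \<union> Q') = {}" "f \<inter> ?P = {y}" "f \<inter> (A \<union> Q') = {y'}"
      using y'(2) sp(1) by (simp_all add: Int_Un_distrib Int_commute)
    have "path_connected (A \<union> Q')"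
      using path_connected_Un[OF pc(1) Q'(1)] inA(1) Q'(4) by blast
    moreover have "path_connected ?P"
      using p(1) by (simp add: arc_imp_path path_connected_path_image)
    moreover have "t a \<in> ?P" "t b \<in> ?P"
      using p(3,4) by (metis pathstart_in_path_image pathfinish_in_path_image)+
    moreover have "A \<union> Q' \<subseteq> C" "f \<subseteq> C"
      using sub Q(3) Q'(2) by blast+
    ultimately have "splits_at C J t"
      using J pc(2) inA(2) Q'(3) p(2) meets by (intro splits_atI[of J a b c d ?P "A \<union> Q'" f C t y y']) auto
    then show ?thesis ..
  qed
qed

section \<open>No fat drawings of \<open>K\<^sub>3\<^sub>,\<^sub>3\<close> and
  \<open>K\<^sub>5\<close>\<close>

lemma fat_drawingD:
  assumes "fat_drawing n R C e t"
  shows "i < n \<Longrightarrow> path_connected (C i)"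
    and "i < n \<Longrightarrow> j < n \<Longrightarrow> i \<noteq> j \<Longrightarrow> C i \<inter> C j = {}"
    and "i < n \<Longrightarrow> j < n \<Longrightarrow> i \<noteq> j \<Longrightarrow> R i j \<Longrightarrow> path_connected (e i j)"
    and "i < n \<Longrightarrow> j < n \<Longrightarrow> i \<noteq> j \<Longrightarrow> R i j \<Longrightarrow> e i j = e j i"
    and "i < n \<Longrightarrow> j < n \<Longrightarrow> i \<noteq> j \<Longrightarrow> R i j \<Longrightarrow> e i j \<inter> C i = {t i j}"
    and "i < n \<Longrightarrow> j < n \<Longrightarrow> i \<noteq> j \<Longrightarrow> R i j \<Longrightarrow> k < n \<Longrightarrow> k \<noteq> i \<Longrightarrow> k \<noteq> j \<Longrightarrow> e i j \<inter> C k = {}"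
    and "i < n \<Longrightarrow> j < n \<Longrightarrow> i \<noteq> j \<Longrightarrow> R i j \<Longrightarrow> t i j \<in> C i"
proof -
  show *: "i < n \<Longrightarrow> j < n \<Longrightarrow> i \<noteq> j \<Longrightarrow> R i j \<Longrightarrow> e i j \<inter> C i = {t i j}"
    using assms by (simp add: fat_drawing_def)
  show "i < n \<Longrightarrow> j < n \<Longrightarrow> i \<noteq> j \<Longrightarrow> R i j \<Longrightarrow> t i j \<in> C i"
    using * by fastforce
qed (use assms in \<open>simp_all add: fat_drawing_def\<close>)

lemma fat_drawing_stars_imp_graph_drawing:
  assumes fd: "fat_drawing n R C e t"
    and st: "\<And>i. i < n \<Longrightarrow> \<exists>x S. star_at (C i) {j. j < n \<and> j \<noteq> i \<and> R i j} (t i) x S"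
  shows "\<exists>v D. graph_drawing n R v D"
proof -
  obtain v S where "\<And>i. i < n \<Longrightarrow> star_at (C i) {j. j < n \<and> j \<noteq> i \<and> R i j} (t i) (v i) (S i)"
    using st by metis
  from stars_imp_graph_drawing[OF fd this] show ?thesis
    by blast
qed

text \<open>Every branch set has exactly three terminals, so \<open>obtain_star3\<close> supplies
  all the stars.\<close>

lemma no_fat_drawing_K33: "\<not> fat_drawing 6 (\<lambda>i j. odd (i + j)) C e t"
proof
  assume fd: "fat_drawing 6 (\<lambda>i j. odd (i + j)) C e t"
  have "\<exists>x S. star_at (C i) {j. j < 6 \<and> j \<noteq> i \<and> odd (i + j)} (t i) x S" if "i < 6" for i
  proof -
    have six: "j < 6 \<longleftrightarrow> j \<in> {0, 1, 2, 3, 4, 5}" for j :: nat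
      by auto
    have J: "{j. j < 6 \<and> j \<noteq> i \<and> odd (i + j)} = (if even i then {1, 3, 5} else {0, 2, 4})"
      unfolding six by auto
    have t: "t i j \<in> C i" if "j \<in> {j. j < 6 \<and> j \<noteq> i \<and> odd (i + j)}" for j
      using fat_drawingD(7)[OF fd \<open>i < 6\<close>, of j] that by simp
    show ?thesis
    proof (cases "even i")
      case True
      show ?thesis
        by (rule obtain_star3[OF fat_drawingD(1)[OF fd that], of _ 1 3 5])
          (use J True t in auto)
    next
      case False
      show ?thesis
        by (rule obtain_star3[OF fat_drawingD(1)[OF fd that], of _ 0 2 4])
          (use J False t in auto)
    qed
  qed
  from fat_drawing_stars_imp_graph_drawing[OF fd this] show False
    using no_drawing_K33 by blast
qed

text \<open>
  Splitting branch set \<open>m\<close> produces \<open>K\<^sub>3\<^sub>,\<^sub>3\<close> with parts \<open>{P1, C c, C d}\<close> (even indices) and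
  \<open>{P2, C a, C b}\<close> (odd indices); \<open>\<psi>\<close> maps an index to its original branch set.
\<close>

lemma fat_drawing_K5_split:
  assumes fd: "fat_drawing 5 (\<lambda>i j. True) C e t"
    and ee: "\<And>i j k l. i < 5 \<Longrightarrow> j < 5 \<Longrightarrow> i \<noteq> j \<Longrightarrow> k < 5 \<Longrightarrow> l < 5 \<Longrightarrow> k \<noteq> l \<Longrightarrow> {i, j} \<noteq> {k, l} \<Longrightarrow> e i j \<inter> e k l = {}"
    and m: "m < 5" and sp: "splits_at (C m) {j. j < 5 \<and> j \<noteq> m} (t m)"
  shows "\<exists>C e t. fat_drawing 6 (\<lambda>i j. odd (i + j)) C e t"
proof -
  note D = fat_drawingD[OF fd, simplified]
  obtain a b c d P1 P2 f s1 s2 where J: "{j. j < 5 \<and> j \<noteq> m} = {a, b, c, d}" and dist: "distinct [a, b, c, d]"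
    and pc: "path_connected P1" "path_connected P2" "path_connected f"
    and sub: "P1 \<subseteq> C m" "P2 \<subseteq> C m" "f \<subseteq> C m"
    and disj: "P1 \<inter> P2 = {}" and t: "t m a \<in> P1" "t m b \<in> P1" "t m c \<in> P2" "t m d \<in> P2"
    and f: "f \<inter> P1 = {s1}" "f \<inter> P2 = {s2}"
    using sp unfolding splits_at_def by (elim exE conjE) (rule that)
  have abcd: "a < 5" "b < 5" "c < 5" "d < 5" "a \<noteq> m" "b \<noteq> m" "c \<noteq> m" "d \<noteq> m"
    using J by blast+
  \<comment> \<open>\<open>P1\<close> carries the terminals towards \<open>C a\<close> and
    \<open>C b\<close>, and \<open>P2\<close> those towards \<open>C c\<close> and
    \<open>C d\<close>. The order of the list makes odd sums select exactly these links, the four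
    links between \<open>{a, b}\<close> and \<open>{c, d}\<close>, and the bridge.\<close>
  define \<psi> where "\<psi> = (!) [m, m, c, a, d, b]"
  define C' where "C' = (!) [P1, P2, C c, C a, C d, C b]"
  \<comment> \<open>\<open>i + j = 1\<close> singles out the pair of the two halves
    \<open>P1\<close> and \<open>P2\<close>, whose link is the bridge.\<close>
  define e' where "e' i j = (if i + j = 1 then f else e (\<psi> i) (\<psi> j))" for i j :: nat
  define t' where "t' i j = (if i = 0 \<and> j = 1 then s1 else if i = 1 \<and> j = 0 then s2 else t (\<psi> i) (\<psi> j))" for i j :: nat
  have six: "j < 6 \<longleftrightarrow> j = 0 \<or> j = 1 \<or> j = 2 \<or> j = 3 \<or> j = 4 \<or> j = 5" for j :: nat
    by auto
  have \<psi>_lt: "\<psi> i < 5" if "i < 6" for i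
    using that m abcd unfolding six by (auto simp: \<psi>_def)
  have \<psi>_eq: "\<psi> i = \<psi> j \<longleftrightarrow> i = j \<or> i + j = 1" if "i < 6" "j < 6" for i j
    using that abcd dist unfolding six by (auto simp: \<psi>_def)
  have \<psi>_m: "\<psi> 0 = m" "\<psi> 1 = m"
    by (simp_all add: \<psi>_def)
  have C'_sub: "C' i \<subseteq> C (\<psi> i)" if "i < 6" for i
    using that sub unfolding six by (auto simp: \<psi>_def C'_def)
  have C'_disj: "C' i \<inter> C' j = {}" if "i < 6" "j < 6" "i \<noteq> j" for i j
  proof (cases "i + j = 1")
    case True
    then have "i = 0 \<and> j = 1 \<or> i = 1 \<and> j = 0"
      by auto
    then show ?thesis
      using disj by (auto simp: C'_def)
  next
    case False
    then have "\<psi> i \<noteq> \<psi> j"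
      using \<psi>_eq that by simp
    then show ?thesis
      using D(2)[OF \<psi>_lt[OF that(1)] \<psi>_lt[OF that(2)]] C'_sub[OF that(1)] C'_sub[OF that(2)] by blast
  qed
  have t_in: "t (\<psi> i) (\<psi> j) \<in> C' i" if ij: "i < 6" "j < 6" "odd (i + j)" "i + j \<noteq> 1" for i j
  proof -
    have "\<psi> i \<noteq> \<psi> j"
      using \<psi>_eq[OF ij(1,2)] ij by auto
    then have *: "t (\<psi> i) (\<psi> j) \<in> C (\<psi> i)"
      using D(7)[OF \<psi>_lt[OF ij(1)] \<psi>_lt[OF ij(2)]] by simp
    consider "i = 0" "j = 3 \<or> j = 5" | "i = 1" "j = 2 \<or> j = 4" | "i \<ge> 2"
      using ij unfolding six by force
    then show ?thesis
    proof cases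
      case 1
      then show ?thesis using t by (auto simp: \<psi>_def C'_def)
    next
      case 2
      then show ?thesis using t by (auto simp: \<psi>_def C'_def)
    next
      case 3
      then have "C' i = C (\<psi> i)"
        using ij(1) unfolding six by (auto simp: \<psi>_def C'_def)
      then show ?thesis using * by simp
    qed
  qed
  have e_C: "e (\<psi> i) (\<psi> j) \<inter> C (\<psi> i) = {t (\<psi> i) (\<psi> j)}" "\<psi> i \<noteq> \<psi> j" "e (\<psi> i) (\<psi> j) = e (\<psi> j) (\<psi> i)"
    "path_connected (e (\<psi> i) (\<psi> j))"
    if ij: "i < 6" "j < 6" "odd (i + j)" "i + j \<noteq> 1" for i j
  proof -
    show *: "\<psi> i \<noteq> \<psi> j"
      using \<psi>_eq[OF ij(1,2)] ij by auto
    show "e (\<psi> i) (\<psi> j) \<inter> C (\<psi> i) = {t (\<psi> i) (\<psi> j)}" "e (\<psi> i) (\<psi> j) = e (\<psi> j) (\<psi> i)"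
        "path_connected (e (\<psi> i) (\<psi> j))"
      using D(3,4,5)[OF \<psi>_lt[OF ij(1)] \<psi>_lt[OF ij(2)] *] by auto
  qed
  \<comment> \<open>A link touches its old branch set only at its terminal, which lies in the half
    \<open>C' i\<close>; hence it misses the other half.\<close>
  have far1: "e (\<psi> i) (\<psi> j) \<inter> C' k = {}"
    if ij: "i < 6" "j < 6" "odd (i + j)" "i + j \<noteq> 1" and k: "k < 6" "k \<noteq> i" "\<psi> k = \<psi> i" for i j k
  proof -
    have "e (\<psi> i) (\<psi> j) \<inter> C' k \<subseteq> {t (\<psi> i) (\<psi> j)}"
      using e_C(1)[OF ij] C'_sub[OF k(1)] k(3) by auto
    then show ?thesis
      using t_in[OF ij] C'_disj[OF k(1) ij(1) k(2)] by blast
  qed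
  have far: "e' i j \<inter> C' k = {}"
    if ij: "i < 6" "j < 6" "odd (i + j)" and k: "k < 6" "k \<noteq> i" "k \<noteq> j" for i j k
  proof (cases "i + j = 1")
    case True
    then have "\<psi> i = m" "\<psi> i \<noteq> \<psi> k"
      using \<psi>_m \<psi>_eq[OF ij(1) k(1)] k by (auto simp: add_is_1)
    then have "C m \<inter> C (\<psi> k) = {}"
      using D(2)[OF m \<psi>_lt[OF k(1)]] by simp
    then show ?thesis
      using True sub(3) C'_sub[OF k(1)] unfolding e'_def by auto
  next
    case False
    have ji: "odd (j + i)" "j + i \<noteq> 1"
      using ij False by (simp_all add: add.commute)
    consider "\<psi> k = \<psi> i" | "\<psi> k = \<psi> j" | "\<psi> k \<noteq> \<psi> i" "\<psi> k \<noteq> \<psi> j"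
      by blast
    then show ?thesis
    proof cases
      case 1
      then show ?thesis
        using far1[OF ij False k(1,2)] False by (simp add: e'_def)
    next
      case 2
      then show ?thesis
        using far1[OF ij(2,1) ji k(1,3)] e_C(3)[OF ij False] False by (simp add: e'_def)
    next
      case 3
      have "e (\<psi> i) (\<psi> j) \<inter> C (\<psi> k) = {}"
        using D(6)[OF \<psi>_lt[OF ij(1)] \<psi>_lt[OF ij(2)] e_C(2)[OF ij False] \<psi>_lt[OF k(1)]] 3 by simp
      then show ?thesis
        using C'_sub[OF k(1)] False unfolding e'_def by auto
    qed
  qed
  have f1: "f \<inter> e (\<psi> k) (\<psi> l) \<subseteq> C' k"
    if kl: "k < 6" "l < 6" "odd (k + l)" "k + l \<noteq> 1" and k: "k = 0 \<or> k = 1" for k l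
  proof -
    have "f \<inter> e (\<psi> k) (\<psi> l) \<subseteq> e (\<psi> k) (\<psi> l) \<inter> C (\<psi> k)"
      using sub(3) k \<psi>_m by auto
    then show ?thesis
      unfolding e_C(1)[OF kl] using t_in[OF kl] by blast
  qed
  have f_meet: "f \<inter> e (\<psi> k) (\<psi> l) \<subseteq> (\<Union>x\<in>{0, 1} \<inter> {k, l}. C' x)"
    if kl: "k < 6" "l < 6" "odd (k + l)" "k + l \<noteq> 1" for k l
  proof -
    have lk: "odd (l + k)" "l + k \<noteq> 1"
      using kl by (simp_all add: add.commute)
    consider "k = 0 \<or> k = 1" | "l = 0 \<or> l = 1" | "k \<ge> 2" "l \<ge> 2"
      by linarith
    then show ?thesis
    proof cases
      case 1
      then show ?thesis using f1[OF kl 1] by blast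
    next
      case 2
      then show ?thesis using f1[OF kl(2,1) lk 2] e_C(3)[OF kl] by auto
    next
      case 3
      then have "m \<noteq> \<psi> k" "m \<noteq> \<psi> l"
        using \<psi>_eq[of 0 k] \<psi>_eq[of 0 l] kl \<psi>_m by auto
      then have "e (\<psi> k) (\<psi> l) \<inter> C m = {}"
        using D(6)[OF \<psi>_lt[OF kl(1)] \<psi>_lt[OF kl(2)] e_C(2)[OF kl] m] by simp
      then show ?thesis
        using sub(3) by blast
    qed
  qed
  have meet: "e' i j \<inter> e' k l \<subseteq> (\<Union>x\<in>{i, j} \<inter> {k, l}. C' x)"
    if ij: "i < 6" "j < 6" "odd (i + j)" and kl: "k < 6" "l < 6" "odd (k + l)" and ne: "{i, j} \<noteq> {k, l}" for i j k l
  proof -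
    have one: "{x, y} = {0, 1}" if "x + y = 1" for x y :: nat
      using that by (auto simp: add_is_1)
    consider "i + j = 1" "k + l \<noteq> 1" | "i + j \<noteq> 1" "k + l = 1" | "i + j \<noteq> 1" "k + l \<noteq> 1"
      using one ne by metis
    then show ?thesis
    proof cases
      case 1
      then show ?thesis
        using f_meet[OF kl 1(2)] one[OF 1(1)] by (simp add: e'_def)
    next
      case 2
      then show ?thesis
        using f_meet[OF ij 2(1)] one[OF 2(2)] by (simp add: e'_def Int_commute)
    next
      case 3
      have "{\<psi> i, \<psi> j} \<noteq> {\<psi> k, \<psi> l}"
      proof
        \<comment> \<open>Indices with the same \<psi> are equal or are 0 and 1. Exchanging 0 and 1
          at one end only would change the parity of the sum; exchanging them at both ends would
          force the sum 1 of the bridge.\<close>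
        have par: "x = y \<and> u = v"
          if "x = y \<or> x + y = 1" "u = v \<or> u + v = 1" "odd (x + u)" "odd (y + v)" "x + u \<noteq> 1" for x y u v :: nat
          using that by (auto simp: add_is_1)
        assume "{\<psi> i, \<psi> j} = {\<psi> k, \<psi> l}"
        then have "\<psi> i = \<psi> k \<and> \<psi> j = \<psi> l \<or> \<psi> i = \<psi> l \<and> \<psi> j = \<psi> k"
          by (simp add: doubleton_eq_iff)
        then have "(i = k \<or> i + k = 1) \<and> (j = l \<or> j + l = 1) \<or> (i = l \<or> i + l = 1) \<and> (j = k \<or> j + k = 1)"
          using \<psi>_eq ij kl by simp
        moreover have "\<not> (i = k \<and> j = l)" "\<not> (i = l \<and> j = k)"
          using ne by auto
        ultimately show False
          using par[of i k j l] par[of i l j k] ij(3) kl(3) 3(1) add.commute[of k l] by metis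
      qed
      then have "e (\<psi> i) (\<psi> j) \<inter> e (\<psi> k) (\<psi> l) = {}"
        using ee[OF \<psi>_lt[OF ij(1)] \<psi>_lt[OF ij(2)] e_C(2)[OF ij 3(1)] \<psi>_lt[OF kl(1)] \<psi>_lt[OF kl(2)] e_C(2)[OF kl 3(2)]]
        by simp
      then show ?thesis
        using 3 by (simp add: e'_def)
    qed
  qed
  have "fat_drawing 6 (\<lambda>i j. odd (i + j)) C' e' t'"
    unfolding fat_drawing_def
  proof (intro conjI allI impI, goal_cases)
    case (1 i)
    then show ?case
      using pc D(1) abcd unfolding six by (auto simp: C'_def)
  next
    case (2 i j)
    then show ?case by (intro C'_disj)
  next
    case (3 i j)
    then show ?case using e_C(4)[of i j] pc(3) by (simp add: e'_def)
  next
    case (4 i j)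
    then show ?case by (simp add: add.commute)
  next
    case (5 i j)
    then show ?case using e_C(3)[of i j] by (simp add: e'_def add.commute)
  next
    case (6 i j)
    show ?case
    proof (cases "i + j = 1")
      case True
      then have "i = 0 \<and> j = 1 \<or> i = 1 \<and> j = 0"
        by auto
      then show ?thesis
        using f by (auto simp: e'_def t'_def C'_def)
    next
      case False
      have ij: "i < 6" "j < 6" "odd (i + j)"
        using 6 by auto
      have "t' i j = t (\<psi> i) (\<psi> j)"
        using False by (auto simp: t'_def)
      moreover have "t (\<psi> i) (\<psi> j) \<in> e (\<psi> i) (\<psi> j)"
        using e_C(1)[OF ij False] by blast
      moreover have "e (\<psi> i) (\<psi> j) \<inter> C' i \<subseteq> {t (\<psi> i) (\<psi> j)}"
        using e_C(1)[OF ij False] C'_sub[OF ij(1)] by blast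
      ultimately show ?thesis
        using t_in[OF ij False] False by (auto simp: e'_def)
    qed
  next
    case (7 i j k)
    then show ?case by (intro far) auto
  next
    case (8 i j k l)
    then show ?case by (intro meet) auto
  qed
  then show ?thesis
    by blast
qed

text \<open>Disjoint links have distinct terminals in a branch set, as
  \<open>star4_or_splits\<close> requires. An H in any branch set would yield a fat
  \<open>K\<^sub>3\<^sub>,\<^sub>3\<close>, so all five contain stars.\<close>

lemma no_fat_drawing_K5:
  assumes fd: "fat_drawing 5 (\<lambda>i j. True) C e t"
    and ee: "\<And>i j k l. i < 5 \<Longrightarrow> j < 5 \<Longrightarrow> i \<noteq> j \<Longrightarrow> k < 5 \<Longrightarrow> l < 5 \<Longrightarrow> k \<noteq> l \<Longrightarrow> {i, j} \<noteq> {k, l} \<Longrightarrow> e i j \<inter> e k l = {}"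
  shows False
proof -
  note D = fat_drawingD[OF fd, simplified]
  have "\<exists>x S. star_at (C m) {j. j < 5 \<and> j \<noteq> m \<and> True} (t m) x S" if m: "m < 5" for m
  proof -
    let ?J = "{j. j < 5 \<and> j \<noteq> m}"
    have five: "j < 5 \<longleftrightarrow> j = 0 \<or> j = 1 \<or> j = 2 \<or> j = 3 \<or> j = 4" for j :: nat
      by auto
    have "\<exists>a b c d. ?J = {a, b, c, d} \<and> distinct [a, b, c, d]"
    proof -
      have "card ?J = 4"
        using m by (simp add: Collect_conj_eq Collect_neg_eq lessThan_def[symmetric] Diff_eq[symmetric] card_Diff_singleton_if)
      then obtain xs where xs: "set xs = ?J" "distinct xs" "length xs = 4"
        using finite_distinct_list[of ?J] distinct_card by fastforce
      then obtain a b c d where "xs = [a, b, c, d]"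
        by (auto simp: numeral_eq_Suc length_Suc_conv)
      then show ?thesis
        using xs by (metis list.simps(15) list.set(1))
    qed
    then obtain a b c d where J: "?J = {a, b, c, d}" "distinct [a, b, c, d]"
      by blast
    have "a \<in> ?J" "b \<in> ?J"
      unfolding J(1) by simp_all
    then have ab: "a < 5" "b < 5" "a \<noteq> m" "b \<noteq> m" "a \<noteq> b"
      using J(2) by auto
    have "t m a \<in> e m a" "t m b \<in> e m b"
      using D(5)[OF m ab(1)] D(5)[OF m ab(2)] ab(3,4) by fastforce+
    moreover have "e m a \<inter> e m b = {}"
      using ab m by (intro ee) (auto simp: doubleton_eq_iff)
    ultimately have "t m a \<noteq> t m b"
      by auto
    moreover have "t m ` ?J \<subseteq> C m"
      using D(7)[OF m] by auto
    ultimately have "(\<exists>x S. star_at (C m) ?J (t m) x S) \<or> splits_at (C m) ?J (t m)"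
      by (intro star4_or_splits[OF D(1)[OF m] J])
    moreover have "\<not> splits_at (C m) ?J (t m)"
      using fat_drawing_K5_split[OF fd ee m] no_fat_drawing_K33 by blast
    ultimately show ?thesis
      by simp
  qed
  from fat_drawing_stars_imp_graph_drawing[OF fd this] show False
    using no_drawing_K5 by blast
qed

section \<open>Clique minors and degrees\<close>

text \<open>Connectivity is stated through cuts instead of walks, so that contraction becomes an
  argument about subsets. The empty set qualifies, which is why nonemptiness appears separately in
  \<open>clique_minor\<close>.\<close>

definition cut_connected :: "('a \<Rightarrow> 'a \<Rightarrow> bool) \<Rightarrow> 'a set \<Rightarrow> bool" where
  "cut_connected E S \<longleftrightarrow> (\<forall>A. A \<subseteq> S \<and> A \<noteq> {} \<and> A \<noteq> S \<longrightarrow> (\<exists>a\<in>A. \<exists>b\<in>S - A. E a b))"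

text \<open>\<open>E\<close> need not be confined to \<open>V\<close>: deleting vertices or passing
  to a neighborhood changes \<open>V\<close> alone.\<close>

definition clique_minor :: "'a set \<Rightarrow> ('a \<Rightarrow> 'a \<Rightarrow> bool) \<Rightarrow> nat \<Rightarrow> bool" where
  "clique_minor V E n \<longleftrightarrow> (\<exists>B. (\<forall>i<n. B i \<subseteq> V \<and> B i \<noteq> {} \<and> cut_connected E (B i)) \<and>
     (\<forall>i<n. \<forall>j<n. i \<noteq> j \<longrightarrow> B i \<inter> B j = {} \<and> (\<exists>x\<in>B i. \<exists>y\<in>B j. E x y)))"

lemma clique_minorE:
  assumes "clique_minor V E n"
  obtains B where "\<And>i. i < n \<Longrightarrow> B i \<subseteq> V \<and> B i \<noteq> {} \<and> cut_connected E (B i)"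
    and "\<And>i j. i < n \<Longrightarrow> j < n \<Longrightarrow> i \<noteq> j \<Longrightarrow> B i \<inter> B j = {} \<and> (\<exists>x\<in>B i. \<exists>y\<in>B j. E x y)"
proof -
  from assms obtain B where B: "\<forall>i<n. B i \<subseteq> V \<and> B i \<noteq> {} \<and> cut_connected E (B i)"
    "\<forall>i<n. \<forall>j<n. i \<noteq> j \<longrightarrow> B i \<inter> B j = {} \<and> (\<exists>x\<in>B i. \<exists>y\<in>B j. E x y)"
    unfolding clique_minor_def by (elim exE conjE)
  show thesis
    by (rule that[of B]) (rule B[rule_format], assumption+)+
qed

lemma cut_connected_singleton: "cut_connected E {x}"
  unfolding cut_connected_def by blast

lemma cut_connected_star:
  assumes sym: "\<And>a b. E a b \<Longrightarrow> E b a" and x: "x \<in> S" and adj: "\<And>y. y \<in> S \<Longrightarrow> y \<noteq> x \<Longrightarrow> E x y"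
  shows "cut_connected E S"
  unfolding cut_connected_def
proof (intro allI impI, elim conjE)
  fix A assume A: "A \<subseteq> S" "A \<noteq> {}" "A \<noteq> S"
  obtain y z where yz: "y \<in> A" "z \<in> S" "z \<notin> A"
    using A by blast
  show "\<exists>a\<in>A. \<exists>b\<in>S - A. E a b"
  proof (cases "x \<in> A")
    case True
    then have "E x z"
      using adj yz by blast
    then show ?thesis
      using True yz by blast
  next
    case False
    then have "E y x"
      using adj[of y] sym yz A(1) by blast
    then show ?thesis
      using False yz x by blast
  qed
qed

text \<open>A cut of the union either splits some \<open>M w\<close>, which supplies the crossing
  edge, or consists of whole sets \<open>M w\<close> and comes from a cut of
  \<open>S\<close>.\<close>

lemma cut_connected_UN:
  assumes S: "cut_connected E' S" and M: "\<And>w. w \<in> S \<Longrightarrow> M w \<noteq> {} \<and> cut_connected E (M w)"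
    and E': "\<And>a b. a \<in> S \<Longrightarrow> b \<in> S \<Longrightarrow> E' a b \<Longrightarrow> a \<noteq> b \<Longrightarrow> \<exists>x\<in>M a. \<exists>y\<in>M b. E x y"
  shows "cut_connected E (\<Union>(M ` S))"
  unfolding cut_connected_def
proof (intro allI impI, elim conjE)
  fix A assume A: "A \<subseteq> \<Union>(M ` S)" "A \<noteq> {}" "A \<noteq> \<Union>(M ` S)"
  show "\<exists>a\<in>A. \<exists>b\<in>\<Union>(M ` S) - A. E a b"
  proof (cases "\<exists>w\<in>S. M w \<inter> A \<noteq> {} \<and> \<not> M w \<subseteq> A")
    case True
    then obtain w where w: "w \<in> S" "M w \<inter> A \<noteq> {}" "\<not> M w \<subseteq> A"
      by blast
    have "\<exists>a\<in>M w \<inter> A. \<exists>b\<in>M w - (M w \<inter> A). E a b"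
    proof -
      have "M w \<inter> A \<noteq> M w"
        using w(3) by blast
      then show ?thesis
        using M[OF w(1)] w(2) unfolding cut_connected_def by (metis inf_le1)
    qed
    then show ?thesis
      using w(1) by blast
  next
    case False
    let ?A' = "{w \<in> S. M w \<subseteq> A}"
    have "?A' \<noteq> {}" "?A' \<noteq> S"
      using A False by blast+
    then obtain a b where ab: "a \<in> ?A'" "b \<in> S - ?A'" "E' a b"
      using S unfolding cut_connected_def by (metis (no_types, lifting) mem_Collect_eq subsetI)
    then obtain x y where "x \<in> M a" "y \<in> M b" "E x y"
      using E'[of a b] by blast
    moreover have "M b \<inter> A = {}"
      using ab(2) False by blast
    ultimately show ?thesis
      using ab by blast
  qed
qed

text \<open>\<open>M w\<close> is the set of vertices contracted to \<open>w\<close>: a minor of a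
  minor is a minor.\<close>

lemma clique_minor_lift:
  assumes cm: "clique_minor V' E' n"
    and M: "\<And>w. w \<in> V' \<Longrightarrow> M w \<subseteq> V \<and> M w \<noteq> {} \<and> cut_connected E (M w)"
    and disj: "\<And>a b. a \<in> V' \<Longrightarrow> b \<in> V' \<Longrightarrow> a \<noteq> b \<Longrightarrow> M a \<inter> M b = {}"
    and E': "\<And>a b. a \<in> V' \<Longrightarrow> b \<in> V' \<Longrightarrow> E' a b \<Longrightarrow> a \<noteq> b \<Longrightarrow> \<exists>x\<in>M a. \<exists>y\<in>M b. E x y"
  shows "clique_minor V E n"
proof -
  obtain B where B: "\<And>i. i < n \<Longrightarrow> B i \<subseteq> V' \<and> B i \<noteq> {} \<and> cut_connected E' (B i)"
    and BB: "\<And>i j. i < n \<Longrightarrow> j < n \<Longrightarrow> i \<noteq> j \<Longrightarrow> B i \<inter> B j = {} \<and> (\<exists>x\<in>B i. \<exists>y\<in>B j. E' x y)"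
    using cm by (elim clique_minorE) (rule that)
  show ?thesis
    unfolding clique_minor_def
  proof (intro exI[of _ "\<lambda>i. \<Union>(M ` B i)"] conjI allI impI)
    fix i assume i: "i < n"
    have Bi: "B i \<subseteq> V'" "B i \<noteq> {}" "cut_connected E' (B i)"
      using B[OF i] by simp_all
    have MB: "M w \<subseteq> V" "M w \<noteq> {} \<and> cut_connected E (M w)" if "w \<in> B i" for w
      using M[of w] Bi(1) that by auto
    show "\<Union>(M ` B i) \<subseteq> V"
      using MB(1) by (rule UN_least)
    show "\<Union>(M ` B i) \<noteq> {}"
      using MB(2) Bi(2) by auto
    show "cut_connected E (\<Union>(M ` B i))"
    proof (rule cut_connected_UN[OF Bi(3) MB(2)])
      show "\<exists>x\<in>M a. \<exists>y\<in>M b. E x y" if "a \<in> B i" "b \<in> B i" "E' a b" "a \<noteq> b" for a b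
        using that Bi(1) by (intro E') auto
    qed
  next
    fix i j assume ij: "i < n" "j < n" "i \<noteq> j"
    have sub: "B i \<subseteq> V'" "B j \<subseteq> V'" "B i \<inter> B j = {}"
      using B ij BB by auto
    have "M a \<inter> M b = {}" if "a \<in> B i" "b \<in> B j" for a b
      using disj[of a b] sub that by blast
    then show "\<Union>(M ` B i) \<inter> \<Union>(M ` B j) = {}"
      by blast
    obtain a b where ab: "a \<in> B i" "b \<in> B j" "E' a b"
      using BB[OF ij] by blast
    then have "a \<noteq> b"
      using sub by blast
    then have "\<exists>x\<in>M a. \<exists>y\<in>M b. E x y"
      using E'[of a b] ab sub by blast
    then show "\<exists>x\<in>\<Union>(M ` B i). \<exists>y\<in>\<Union>(M ` B j). E x y"
      using ab by blast
  qed
qed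

lemma clique_minor_mono:
  assumes "clique_minor V' E n" "V' \<subseteq> V"
  shows "clique_minor V E n"
proof -
  obtain B where B: "\<And>i. i < n \<Longrightarrow> B i \<subseteq> V' \<and> B i \<noteq> {} \<and> cut_connected E (B i)"
    and BB: "\<And>i j. i < n \<Longrightarrow> j < n \<Longrightarrow> i \<noteq> j \<Longrightarrow> B i \<inter> B j = {} \<and> (\<exists>x\<in>B i. \<exists>y\<in>B j. E x y)"
    using assms(1) by (elim clique_minorE) (rule that)
  show ?thesis
    unfolding clique_minor_def
    by (rule exI[of _ B]) (use B BB assms(2) in \<open>simp add: subset_trans[OF _ assms(2)]\<close>)
qed

text \<open>The additional branch set is \<open>{v}\<close>; the others consist of neighbors of
  \<open>v\<close>.\<close>

lemma clique_minor_Suc: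
  assumes sym: "\<And>a b. E a b \<Longrightarrow> E b a" and cm: "clique_minor {w \<in> V. E v w} E n" and v: "v \<in> V" "\<not> E v v"
  shows "clique_minor V E (Suc n)"
proof -
  obtain B where B: "\<And>i. i < n \<Longrightarrow> B i \<subseteq> {w \<in> V. E v w} \<and> B i \<noteq> {} \<and> cut_connected E (B i)"
    and BB: "\<And>i j. i < n \<Longrightarrow> j < n \<Longrightarrow> i \<noteq> j \<Longrightarrow> B i \<inter> B j = {} \<and> (\<exists>x\<in>B i. \<exists>y\<in>B j. E x y)"
    using cm by (elim clique_minorE) (rule that)
  have vB: "v \<notin> B i \<and> (\<exists>y\<in>B i. E v y) \<and> (\<exists>y\<in>B i. E y v)" if "i < n" for i
    using B[OF that] v sym by blast
  show ?thesis
    unfolding clique_minor_def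
  proof (intro exI[of _ "B(n := {v})"] conjI allI impI)
    fix i j assume ij: "i < Suc n" "j < Suc n" "i \<noteq> j"
    then consider "i < n" "j < n" | "i = n" "j < n" | "i < n" "j = n"
      by linarith
    then have "(B(n := {v})) i \<inter> (B(n := {v})) j = {} \<and> (\<exists>x\<in>(B(n := {v})) i. \<exists>y\<in>(B(n := {v})) j. E x y)"
      by cases (use BB[of i j] vB[of i] vB[of j] ij in auto)
    then show "(B(n := {v})) i \<inter> (B(n := {v})) j = {}" "\<exists>x\<in>(B(n := {v})) i. \<exists>y\<in>(B(n := {v})) j. E x y"
      by blast+
  next
    fix i assume i: "i < Suc n"
    have "(B(n := {v})) i \<subseteq> V \<and> (B(n := {v})) i \<noteq> {} \<and> cut_connected E ((B(n := {v})) i)"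
      using B[of i] i v(1) by (cases "i = n") (auto simp: cut_connected_singleton)
    then show "(B(n := {v})) i \<subseteq> V" "(B(n := {v})) i \<noteq> {}" "cut_connected E ((B(n := {v})) i)"
      by blast+
  qed
qed

section \<open>Edge density and Mader's argument\<close>

text \<open>Contracting \<open>x y\<close> loses that edge and, for each common neighbor, one of two
  edges that become parallel. Edges are counted as ordered pairs, hence the factors 2.\<close>

lemma card_contracted_edges:
  fixes V :: "'a set"
  assumes fin: "finite V" and sym: "\<And>a b. E a b \<Longrightarrow> E b a" and irr: "\<And>a. \<not> E a a"
    and xy: "x \<in> V" "y \<in> V" "E x y"
  defines "E' \<equiv> \<lambda>a b. a \<noteq> b \<and> (E a b \<or> (a = x \<and> E y b) \<or> (b = x \<and> E a y))"
  shows "card {(a, b) \<in> V \<times> V. E a b}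
    \<le> card {(a, b) \<in> (V - {y}) \<times> (V - {y}). E' a b} + 2 + 2 * card {b \<in> V. E x b \<and> E y b}"
proof -
  have ne: "x \<noteq> y"
    using xy irr by blast
  define N where "N = {(a, b) \<in> (V - {y}) \<times> (V - {y}). E a b}"
  define Y where "Y = {b \<in> V. E y b}"
  \<comment> \<open>\<open>Z\<close> holds the neighbors that \<open>x\<close> gains from
    \<open>y\<close>, \<open>W\<close> the common ones whose two edges merge.\<close>
  define Z where "Z = {b \<in> V. E y b \<and> b \<noteq> x \<and> \<not> E x b}"
  define W where "W = {b \<in> V. E x b \<and> E y b}"
  have finN: "finite N" "finite Y" "finite Z" "finite W"
    using fin by (auto simp: N_def Y_def Z_def W_def intro: finite_subset[of _ "V \<times> V"])
  have "{(a, b) \<in> V \<times> V. E a b} = N \<union> ({y} \<times> Y \<union> Y \<times> {y})"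
    using sym xy irr by (auto simp: N_def Y_def)
  also have "card \<dots> = card N + card ({y} \<times> Y \<union> Y \<times> {y})"
    using finN by (intro card_Un_disjoint) (auto simp: N_def)
  also have "card ({y} \<times> Y \<union> Y \<times> {y}) = card ({y} \<times> Y) + card (Y \<times> {y})"
    using finN irr by (intro card_Un_disjoint) (auto simp: Y_def)
  finally have 1: "card {(a, b) \<in> V \<times> V. E a b} = card N + 2 * card Y"
    by (simp add: card_cartesian_product)
  have "Y = insert x (Z \<union> W)"
    using xy sym irr by (auto simp: Y_def Z_def W_def)
  moreover have "card (Z \<union> W) = card Z + card W"
    using finN by (intro card_Un_disjoint) (auto simp: Z_def W_def)
  moreover have "x \<notin> Z \<union> W"
    using irr by (auto simp: Z_def W_def)
  ultimately have 2: "card Y = Suc (card Z + card W)"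
    using finN by simp
  have "card N + 2 * card Z = card (N \<union> ({x} \<times> Z \<union> Z \<times> {x}))"
  proof -
    have "card (N \<union> ({x} \<times> Z \<union> Z \<times> {x})) = card N + card ({x} \<times> Z \<union> Z \<times> {x})"
      using finN sym by (intro card_Un_disjoint) (auto simp: N_def Z_def)
    also have "card ({x} \<times> Z \<union> Z \<times> {x}) = card ({x} \<times> Z) + card (Z \<times> {x})"
      using finN by (intro card_Un_disjoint) (auto simp: Z_def)
    finally show ?thesis
      by (simp add: card_cartesian_product)
  qed
  also have "\<dots> \<le> card {(a, b) \<in> (V - {y}) \<times> (V - {y}). E' a b}"
  proof (rule card_mono)
    show "finite {(a, b) \<in> (V - {y}) \<times> (V - {y}). E' a b}"
      using fin by (auto intro: finite_subset[of _ "V \<times> V"])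
    show "N \<union> ({x} \<times> Z \<union> Z \<times> {x}) \<subseteq> {(a, b) \<in> (V - {y}) \<times> (V - {y}). E' a b}"
      using ne xy irr sym by (auto simp: N_def Z_def E'_def)
  qed
  finally show ?thesis
    using 1 2 by (simp add: W_def)
qed

text \<open>
  Contract edges with fewer than \<open>k\<close> common neighbors, which preserves the density; once there are
  none left, every neighborhood has minimum degree at least \<open>k\<close>.
\<close>

lemma dense_imp_clique_minor:
  fixes V :: "'a set"
  assumes IH: "\<And>(V :: 'a set) E. finite V \<Longrightarrow> V \<noteq> {} \<Longrightarrow> (\<And>a b. E a b \<Longrightarrow> E b a) \<Longrightarrow> (\<And>a. \<not> E a a)
      \<Longrightarrow> (\<And>v. v \<in> V \<Longrightarrow> k \<le> card {w \<in> V. E v w}) \<Longrightarrow> clique_minor V E n"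
    and k: "0 < k"
    and V: "finite V" "V \<noteq> {}" and E: "\<And>a b. E a b \<Longrightarrow> E b a" "\<And>a. \<not> E a a"
    and dense: "2 * k * card V \<le> card {(a, b) \<in> V \<times> V. E a b}"
  shows "clique_minor V E (Suc n)"
  using V E dense
proof (induction "card V" arbitrary: V E rule: less_induct)
  case less
  note sym = less.prems(3) and irr = less.prems(4)
  show ?case
  proof (cases "\<exists>x\<in>V. \<exists>y\<in>V. E x y \<and> card {b \<in> V. E x b \<and> E y b} < k")
    case True
    then obtain x y where xy: "x \<in> V" "y \<in> V" "E x y" and c: "card {b \<in> V. E x b \<and> E y b} < k"
      by blast
    have ne: "x \<noteq> y"
      using xy irr by blast
    let ?E = "\<lambda>a b. a \<noteq> b \<and> (E a b \<or> (a = x \<and> E y b) \<or> (b = x \<and> E a y))"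
    have cV: "card V = Suc (card (V - {y}))"
      using less.prems(1) xy(2) by (metis card.remove)
    have "2 * k * card V = 2 * k * card (V - {y}) + 2 * k"
      unfolding cV by simp
    \<comment> \<open>Fewer than \<open>k\<close> common neighbors means a loss of at most
      \<open>2 + 2 * (k - 1)\<close> arcs, exactly what the bound gives up for one vertex.\<close>
    then have dense': "2 * k * card (V - {y}) \<le> card {(a, b) \<in> (V - {y}) \<times> (V - {y}). ?E a b}"
      using card_contracted_edges[OF less.prems(1) sym irr xy] less.prems(5) c by linarith
    have "clique_minor (V - {y}) ?E (Suc n)"
    proof (rule less.hyps[OF _ _ _ _ _ dense'])
      show "V - {y} \<noteq> {}"
        using xy(1) ne by blast
    qed (use less.prems(1) cV sym in auto)
    then show ?thesis
    proof (rule clique_minor_lift[where M = "\<lambda>a. if a = x then {x, y} else {a}"])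
      fix w assume "w \<in> V - {y}"
      moreover have "cut_connected E {x, y}"
        by (rule cut_connected_star[of E x]) (use sym xy in auto)
      ultimately show "(if w = x then {x, y} else {w}) \<subseteq> V \<and> (if w = x then {x, y} else {w}) \<noteq> {} \<and>
          cut_connected E (if w = x then {x, y} else {w})"
        using xy by (auto simp: cut_connected_singleton)
    qed (auto split: if_splits)
  next
    case False
    \<comment> \<open>Positive \<open>k\<close> forces an edge, hence a vertex with nonempty
      neighborhood, as \<open>IH\<close> demands.\<close>
    have "0 < card V"
      using less.prems(1,2) by (simp add: card_gt_0_iff)
    then have "card {(a, b) \<in> V \<times> V. E a b} \<noteq> 0"
      using less.prems(5) k by (metis mult_pos_pos not_le zero_less_numeral)
    then have "{(a, b) \<in> V \<times> V. E a b} \<noteq> {}"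
      by (metis card.empty)
    then obtain v u where vu: "v \<in> V" "u \<in> V" "E v u"
      by auto
    have "clique_minor {w \<in> V. E v w} E n"
    proof (rule IH[OF _ _ sym irr])
      fix w assume w: "w \<in> {w \<in> V. E v w}"
      then have "k \<le> card {b \<in> V. E v b \<and> E w b}"
        using False vu(1) by (metis (mono_tags, lifting) mem_Collect_eq not_le)
      then show "k \<le> card {b \<in> {w \<in> V. E v w}. E w b}"
        by (simp add: conj_assoc)
    qed (use vu less.prems(1) in auto)
    then show ?thesis
      using sym irr vu(1) by (intro clique_minor_Suc) auto
  qed
qed

lemma sum_degrees:
  assumes "finite V"
  shows "card {(a, b) \<in> V \<times> V. E a b} = (\<Sum>v\<in>V. card {w \<in> V. E v w})"
proof -
  have "{(a, b) \<in> V \<times> V. E a b} = Sigma V (\<lambda>v. {w \<in> V. E v w})"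
    by auto
  then show ?thesis
    using assms by (simp add: card_SigmaI)
qed

text \<open>Minimum degree \<open>2 ^ Suc m\<close> amounts to the density needed with
  \<open>k = 2 ^ m\<close>, and the induction hypothesis then applies inside a neighborhood. Each
  doubling of the degree buys one more branch set.\<close>

lemma min_degree_imp_clique_minor:
  fixes V :: "'a set"
  assumes "finite V" "V \<noteq> {}" "\<And>a b. E a b \<Longrightarrow> E b a" "\<And>a. \<not> E a a"
    and "\<And>v. v \<in> V \<Longrightarrow> 2 ^ m \<le> card {w \<in> V. E v w}"
  shows "clique_minor V E (m + 2)"
  using assms
proof (induction m arbitrary: V E)
  case 0
  then obtain v where v: "v \<in> V"
    by blast
  then have "1 \<le> card {w \<in> V. E v w}"
    using "0.prems"(5) by simp
  then obtain w where w: "w \<in> V" "E v w"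
    by (metis (no_types, lifting) Collect_empty_eq card.empty not_one_le_zero)
  have "clique_minor {u \<in> V. E v u} E 1"
    unfolding clique_minor_def
    by (rule exI[of _ "\<lambda>_. {w}"]) (use w in \<open>auto simp: cut_connected_singleton\<close>)
  then show ?case
    using clique_minor_Suc[of E V v 1] "0.prems" v by (simp add: numeral_2_eq_2)
next
  case (Suc m)
  have "2 * 2 ^ m * card V \<le> (\<Sum>v\<in>V. card {w \<in> V. E v w})"
    using sum_bounded_below[of V "2 ^ Suc m" "\<lambda>v. card {w \<in> V. E v w}"] Suc.prems(5) by (simp add: mult.commute)
  then have dense: "2 * 2 ^ m * card V \<le> card {(a, b) \<in> V \<times> V. E a b}"
    unfolding sum_degrees[OF Suc.prems(1)] .
  have "clique_minor V E (Suc (m + 2))"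
    by (rule dense_imp_clique_minor[where k = "2 ^ m", OF Suc.IH _ Suc.prems(1-4) dense]) auto
  then show ?case
    by simp
qed

section \<open>Colorings\<close>

definition proper_coloring :: "'a set \<Rightarrow> ('a \<Rightarrow> 'a \<Rightarrow> bool) \<Rightarrow> nat \<Rightarrow> ('a \<Rightarrow> nat) \<Rightarrow> bool" where
  "proper_coloring V E k c \<longleftrightarrow> c ` V \<subseteq> {..<k} \<and> (\<forall>u\<in>V. \<forall>v\<in>V. E u v \<longrightarrow> c u \<noteq> c v)"

text \<open>The bound is on the colors seen at \<open>v\<close>, not on its degree, because two of
  seven neighbors will be made to share a color.\<close>

lemma proper_coloring_extend:
  assumes c: "proper_coloring (V - {v}) E k c" and sym: "\<And>a b. E a b \<Longrightarrow> E b a" and irr: "\<not> E v v"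
    and few: "card (c ` {w \<in> V. E v w}) < k" and fin: "finite V"
  shows "\<exists>c. proper_coloring V E k c"
proof -
  have "\<not> {..<k} \<subseteq> c ` {w \<in> V. E v w}"
    using few fin card_mono[of "c ` {w \<in> V. E v w}" "{..<k}"] by auto
  then obtain x where x: "x < k" "x \<notin> c ` {w \<in> V. E v w}"
    by auto
  have "proper_coloring V E k (c(v := x))"
    using c x sym irr unfolding proper_coloring_def by (auto simp: image_subset_iff)
  then show ?thesis by blast
qed

lemma K5_minor_free_imp_7_colorable:
  fixes V :: "'a set"
  assumes "finite V" "\<And>a b. E a b \<Longrightarrow> E b a" "\<And>a. \<not> E a a" "\<not> clique_minor V E 5"
  shows "\<exists>c. proper_coloring V E 7 c"
  using assms
proof (induction "card V" arbitrary: V E rule: less_induct)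
  case less
  note fin = less.prems(1) and sym = less.prems(2) and irr = less.prems(3) and free = less.prems(4)
  show ?case
  proof (cases "V = {}")
    case True
    then show ?thesis
      by (intro exI[of _ "\<lambda>_. 0"]) (simp add: proper_coloring_def)
  next
    case False
    obtain v where v: "v \<in> V" and dv: "card {w \<in> V. E v w} < 8"
      using min_degree_imp_clique_minor[OF fin False, of E 3] sym irr free by (force simp: not_le)
    let ?N = "{w \<in> V. E v w}"
    have finN: "finite ?N"
      using fin by simp
    show ?thesis
    proof (cases "card ?N = 7")
      case False
      have "\<not> clique_minor (V - {v}) E 5"
        using free clique_minor_mono[of "V - {v}" E 5 V] by blast
      then obtain c where "proper_coloring (V - {v}) E 7 c"
        using less.hyps[OF card_Diff1_less[OF fin v], of E] fin sym irr by blast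
      moreover have "card (c ` ?N) < 7"
        using card_image_le[OF finN, of c] dv False by linarith
      ultimately show ?thesis
        using proper_coloring_extend[of V v E 7 c] sym irr fin by blast
    next
      case True
      \<comment> \<open>Otherwise five of the seven neighbors, as singletons, would already form the
        forbidden minor.\<close>
      have "\<exists>x\<in>?N. \<exists>y\<in>?N. x \<noteq> y \<and> \<not> E x y"
      proof (rule ccontr)
        assume "\<not> ?thesis"
        then have adj: "\<And>x y. x \<in> ?N \<Longrightarrow> y \<in> ?N \<Longrightarrow> x \<noteq> y \<Longrightarrow> E x y"
          by blast
        obtain b where b: "bij_betw b {0..<7::nat} ?N"
          using ex_bij_betw_nat_finite[OF finN] True by auto
        have bN: "b i \<in> ?N" if "i < 7" for i
          using bij_betwE[OF b] that by auto
        have inj: "b i \<noteq> b j" if "i < 7" "j < 7" "i \<noteq> j" for i j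
          using inj_onD[OF bij_betw_imp_inj_on[OF b]] that by force
        have "clique_minor V E 5"
          unfolding clique_minor_def
        proof (intro exI[of _ "\<lambda>i. {b i}"] conjI allI impI)
          fix i j :: nat assume ij: "i < 5" "j < 5" "i \<noteq> j"
          then have "b i \<noteq> b j"
            using inj by simp
          then show "{b i} \<inter> {b j} = {}" "\<exists>x\<in>{b i}. \<exists>y\<in>{b j}. E x y"
            using adj[of "b i" "b j"] bN[of i] bN[of j] ij by auto
        next
          fix i :: nat assume i: "i < 5"
          then show "{b i} \<subseteq> V"
            using bN[of i] by auto
        qed (auto simp: cut_connected_singleton)
        then show False
          using free by blast
      qed
      then obtain x y where xy: "x \<in> V" "y \<in> V" "E v x" "E v y" "x \<noteq> y" "\<not> E x y"
        by blast
      have vxy: "v \<noteq> x" "v \<noteq> y"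
        using xy irr by auto
      let ?V = "V - {x, y}" and ?M = "\<lambda>a. if a = v then {v, x, y} else {a}"
      let ?E = "\<lambda>a b. a \<noteq> b \<and> (\<exists>a'\<in>?M a. \<exists>b'\<in>?M b. E a' b')"
      have "\<not> clique_minor ?V ?E 5"
      proof
        assume "clique_minor ?V ?E 5"
        then have "clique_minor V E 5"
        proof (rule clique_minor_lift[where M = ?M])
          fix w assume "w \<in> ?V"
          moreover have "cut_connected E {v, x, y}"
            by (rule cut_connected_star[of E v]) (use sym xy in auto)
          ultimately show "?M w \<subseteq> V \<and> ?M w \<noteq> {} \<and> cut_connected E (?M w)"
            using v xy by (auto simp: cut_connected_singleton)
        qed (auto split: if_splits)
        then show False
          using free by blast
      qed
      moreover have "card ?V < card V"
        using fin xy by (intro psubset_card_mono) auto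
      moreover have "?E b a" if "?E a b" for a b
        using that sym by blast
      ultimately obtain c where c: "proper_coloring ?V ?E 7 c"
        using less.hyps[of ?V ?E] fin by blast
      \<comment> \<open>Undo the contraction: \<open>x\<close> and \<open>y\<close> inherit the
        color of the merged vertex, which is legal since they are nonadjacent, and \<open>v\<close>
        is colored last, seeing at most six colors.\<close>
      let ?c = "c(x := c v, y := c v)"
      have vV: "v \<in> ?V"
        using v vxy by simp
      have cv: "c v \<noteq> c b" if "b \<in> ?V" "b \<noteq> v" "E x b \<or> E y b" for b
      proof -
        have "?E v b"
          using that by auto
        then show ?thesis
          using c vV that(1) unfolding proper_coloring_def by blast
      qed
      have cc: "c a \<noteq> c b" if "a \<in> ?V" "b \<in> ?V" "E a b" for a b
      proof -
        have "?E a b"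
          using that(3) irr by auto
        then show ?thesis
          using c that(1,2) unfolding proper_coloring_def by blast
      qed
      have "proper_coloring (V - {v}) E 7 ?c"
        unfolding proper_coloring_def
      proof (intro conjI ballI impI)
        show "?c ` (V - {v}) \<subseteq> {..<7}"
          using c vV unfolding proper_coloring_def by (auto simp: image_subset_iff)
        fix a b assume a: "a \<in> V - {v}" and b: "b \<in> V - {v}" and ab: "E a b"
        consider "a \<in> {x, y}" "b \<in> {x, y}" | "a \<in> {x, y}" "b \<notin> {x, y}" | "a \<notin> {x, y}" "b \<in> {x, y}"
          | "a \<notin> {x, y}" "b \<notin> {x, y}"
          by blast
        then show "?c a \<noteq> ?c b"
        proof cases
          case 1
          then show ?thesis using ab xy(6) irr sym by auto
        next
          case 2
          then have "c v \<noteq> c b"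
            using cv[of b] a b ab by auto
          then show ?thesis using 2 by auto
        next
          case 3
          then have "c v \<noteq> c a"
            using cv[of a] a b sym[OF ab] by auto
          then show ?thesis using 3 by auto
        next
          case 4
          then show ?thesis using cc[of a b] a b ab by auto
        qed
      qed
      moreover have "card (?c ` ?N) < 7"
      proof -
        have "?c ` ?N \<subseteq> ?c ` (?N - {y})"
        proof
          fix z assume "z \<in> ?c ` ?N"
          then obtain w where w: "w \<in> ?N" "z = ?c w"
            by blast
          then have "z = ?c (if w = y then x else w)" "(if w = y then x else w) \<in> ?N - {y}"
            using xy by auto
          then show "z \<in> ?c ` (?N - {y})"
            by blast
        qed
        then have "card (?c ` ?N) \<le> card (?N - {y})"
          using finN by (meson card_image_le card_mono finite_Diff finite_imageI le_trans)
        also have "\<dots> < 7"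
          using True xy finN by (simp add: card_Diff_singleton_if)
        finally show ?thesis .
      qed
      ultimately show ?thesis
        using proper_coloring_extend[of V v E 7 ?c] sym irr fin by blast
    qed
  qed
qed

section \<open>The conflict-free coloring\<close>

text \<open>Let \<open>v\<close> lie outside \<open>N\<close>. None of its neighbors is in
  \<open>X\<close>, so all its colored neighbors are in \<open>J\<close>. Since \<open>v\<close>
  belongs to the branch set of \<open>f v\<close>, each of them other than \<open>f v\<close> is
  adjacent to \<open>f v\<close> in the minor and has another color.\<close>

lemma K5_minor_free_imp_conflict_free:
  fixes V :: "'a set"
  assumes fin: "finite V" and sym: "\<And>a b. E a b \<Longrightarrow> E b a" and irr: "\<And>a. \<not> E a a"
    and EV: "\<And>a b. E a b \<Longrightarrow> a \<in> V \<and> b \<in> V" and iso: "\<And>v. v \<in> V \<Longrightarrow> \<exists>w. E v w"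
    and free: "\<not> clique_minor V E 5"
  shows "\<exists>c. dom c \<subseteq> V \<and> ran c \<subseteq> {1..8::nat} \<and>
    (\<forall>v\<in>V. \<exists>w\<in>{w. E v w} \<inter> dom c. \<forall>w'\<in>{w. E v w} \<inter> dom c. w' \<noteq> w \<longrightarrow> c w' \<noteq> c w)"
proof -
  define far where "far X \<longleftrightarrow> X \<subseteq> V \<and> (\<forall>a\<in>X. \<forall>b\<in>X. a \<noteq> b \<longrightarrow> \<not> E a b \<and> \<not> (\<exists>z. E a z \<and> E b z))" for X
  have "\<exists>X. far X \<and> (\<forall>Y. far Y \<longrightarrow> card Y \<le> card X)"
  proof (rule ex_has_greatest_nat)
    show "far {}"
      by (simp add: far_def)
    show "\<forall>Y. far Y \<longrightarrow> card Y < Suc (card V)"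
      using card_mono[OF fin] by (simp add: far_def less_Suc_eq_le)
  qed
  then obtain X where far_X: "far X" and max: "\<And>Y. far Y \<Longrightarrow> card Y \<le> card X"
    by auto
  have X: "X \<subseteq> V" "\<And>a b. a \<in> X \<Longrightarrow> b \<in> X \<Longrightarrow> a \<noteq> b \<Longrightarrow> \<not> E a b"
    "\<And>a b z. a \<in> X \<Longrightarrow> b \<in> X \<Longrightarrow> a \<noteq> b \<Longrightarrow> E a z \<Longrightarrow> \<not> E b z"
    using far_X by (auto simp: far_def)
  define N where "N = {z. \<exists>u\<in>X. E u z}"
  have XV: "X \<subseteq> V" "finite X"
    using X(1) finite_subset[OF X(1) fin] by simp_all
  have XN: "X \<inter> N = {}"
  proof (rule ccontr)
    assume "\<not> ?thesis"
    then obtain z u where "z \<in> X" "u \<in> X" "E u z"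
      unfolding N_def by blast
    then show False
      using X(2) irr by metis
  qed
  have uniq: "a = b" if "a \<in> X" "b \<in> X" "E a z" "E b z" for a b z
    using X(3) that by metis
  \<comment> \<open>For \<open>w\<close> in \<open>X\<close> any neighbor will do. Otherwise
    maximality gives a vertex of \<open>X\<close> within distance two of \<open>w\<close>; adjacency
    is excluded by \<open>w\<close> not being in \<open>N\<close>, and the middle vertex is in
    \<open>N\<close>.\<close>
  have "\<exists>z\<in>N. E w z" if w: "w \<in> V - N" for w
  proof (cases "w \<in> X")
    case True
    then show ?thesis
      using iso[of w] w unfolding N_def by blast
  next
    case False
    have not_far: "\<not> far (insert w X)"
    proof
      assume "far (insert w X)"
      then have "card (insert w X) \<le> card X"
        by (rule max)
      then show False
        using False XV(2) by simp
    qed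
    have "\<exists>u\<in>X. E w u \<or> E u w \<or> (\<exists>z. E w z \<and> E u z)"
    proof (rule ccontr)
      assume no: "\<not> ?thesis"
      have "\<not> E a b \<and> \<not> (\<exists>z. E a z \<and> E b z)" if "a \<in> insert w X" "b \<in> insert w X" "a \<noteq> b" for a b
        using X(2,3)[of a b] no that by auto
      then have "far (insert w X)"
        using w XV(1) by (simp add: far_def)
      then show False
        using not_far by simp
    qed
    then obtain u where u: "u \<in> X" "E w u \<or> E u w \<or> (\<exists>z. E w z \<and> E u z)"
      by blast
    moreover have "\<not> E u w" "\<not> E w u"
      using w u(1) sym unfolding N_def by blast+
    ultimately show ?thesis
      unfolding N_def by blast
  qed
  then obtain f where f: "\<And>w. w \<in> V - N \<Longrightarrow> f w \<in> N \<and> E w (f w)"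
    by metis
  define J where "J = f ` (V - N)"
  \<comment> \<open>Only vertices outside \<open>N\<close> are absorbed, while all centers lie in
    \<open>N\<close>; hence the branch sets are disjoint.\<close>
  define M where "M j = insert j {w \<in> V - N. f w = j}" for j
  have JN: "J \<subseteq> N" "N \<subseteq> V"
    using f EV by (auto simp: J_def N_def)
  let ?E = "\<lambda>a b. a \<noteq> b \<and> (\<exists>x\<in>M a. \<exists>y\<in>M b. E x y)"
  have "\<not> clique_minor J ?E 5"
  proof
    assume "clique_minor J ?E 5"
    then have "clique_minor V E 5"
    proof (rule clique_minor_lift[where M = M])
      fix j assume j: "j \<in> J"
      have "cut_connected E (M j)"
        by (rule cut_connected_star[of E j]) (use f sym in \<open>auto simp: M_def\<close>)
      then show "M j \<subseteq> V \<and> M j \<noteq> {} \<and> cut_connected E (M j)"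
        using j JN by (auto simp: M_def)
    next
      fix a b assume "a \<in> J" "b \<in> J" "a \<noteq> b"
      then show "M a \<inter> M b = {}"
        using JN by (auto simp: M_def)
    qed auto
    then show False
      using free by blast
  qed
  moreover have "finite J"
    using fin by (simp add: J_def)
  moreover have "?E b a" if "?E a b" for a b
    using that sym by blast
  ultimately obtain c where c: "proper_coloring J ?E 7 c"
    using K5_minor_free_imp_7_colorable[of J ?E] by blast
  \<comment> \<open>\<open>Suc\<close> moves the colors 0 to 6 of the minor to 1 to 7 and leaves 8
    for \<open>X\<close>; all remaining vertices stay uncolored.\<close>
  define d where "d v = (if v \<in> X then Some 8 else if v \<in> J then Some (Suc (c v)) else None)" for v
  have XJ: "X \<inter> J = {}"
    using XN JN by blast
  have dom: "dom d = X \<union> J"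
    by (auto simp: d_def split: if_splits)
  have cJ: "c j < 7" if "j \<in> J" for j
    using c that unfolding proper_coloring_def by auto
  have dJ: "d j = Some (Suc (c j))" if "j \<in> J" for j
    using XJ that by (auto simp: d_def)
  have dX: "d x = Some 8" if "x \<in> X" for x
    using that by (simp add: d_def)
  have "ran d \<subseteq> {1..8}"
    using cJ by (fastforce simp: ran_def d_def split: if_splits)
  moreover have "\<exists>w\<in>{w. E v w} \<inter> dom d. \<forall>w'\<in>{w. E v w} \<inter> dom d. w' \<noteq> w \<longrightarrow> d w' \<noteq> d w" if v: "v \<in> V" for v
  proof (cases "v \<in> N")
    case True
    then obtain u where u: "u \<in> X" "E u v"
      by (auto simp: N_def)
    have "d w' \<noteq> d u" if "E v w'" "w' \<in> X \<union> J" "w' \<noteq> u" for w'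
    proof -
      have "w' \<notin> X"
        using uniq[OF u(1) _ u(2) sym[OF that(1)]] that(3) by auto
      then have "w' \<in> J"
        using that(2) by simp
      then show ?thesis
        using dJ[of w'] cJ[of w'] dX[OF u(1)] by simp
    qed
    then show ?thesis
      unfolding dom using u(1) sym[OF u(2)] by (intro bexI[of _ u]) simp_all
  next
    case False
    then have fv: "f v \<in> J" "E v (f v)" "v \<in> M (f v)"
      using f v by (auto simp: J_def M_def)
    have "d w' \<noteq> d (f v)" if "E v w'" "w' \<in> X \<union> J" "w' \<noteq> f v" for w'
    proof -
      have "w' \<notin> X"
        using False that(1) sym unfolding N_def by blast
      then have w': "w' \<in> J"
        using that by blast
      have "?E (f v) w'"
        using that(1,3) fv(3) by (auto simp: M_def)
      then have "c (f v) \<noteq> c w'"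
        using c fv(1) w' unfolding proper_coloring_def by blast
      then show ?thesis
        using dJ[OF w'] dJ[OF fv(1)] by simp
    qed
    then show ?thesis
      unfolding dom using fv(1,2) by (intro bexI[of _ "f v"]) simp_all
  qed
  moreover have "dom d \<subseteq> V"
    unfolding dom using XV(1) JN by blast
  ultimately show ?thesis
    by (intro exI[of _ d]) simp
qed

section \<open>Plane graphs have no \<open>K\<^sub>5\<close> minor\<close>

text \<open>
  Branch sets of vertices are fattened by their inner edges and the first third of each chosen
  connecting edge; the middle thirds serve as links, so that they are disjoint even where the edges share an end.
\<close>

lemma plane_graph_no_K5_minor:
  fixes V :: "'a set" and p :: "'a \<Rightarrow> complex" and \<gamma> :: "'a \<times> 'a \<Rightarrow> real \<Rightarrow> complex"
  assumes sym: "\<And>u v. E u v \<Longrightarrow> E v u" and irr: "\<And>u. \<not> E u u" and EV: "\<And>u v. E u v \<Longrightarrow> u \<in> V \<and> v \<in> V"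
    and p: "inj_on p V"
    and arc: "\<And>u v. E u v \<Longrightarrow> arc (\<gamma> (u, v)) \<and> pathstart (\<gamma> (u, v)) = p u \<and> pathfinish (\<gamma> (u, v)) = p v \<and>
        \<gamma> (v, u) = reversepath (\<gamma> (u, v)) \<and> path_image (\<gamma> (u, v)) \<inter> p ` V = {p u, p v}"
    and meet: "\<And>u v x y. E u v \<Longrightarrow> E x y \<Longrightarrow> {u, v} \<noteq> {x, y} \<Longrightarrow>
        path_image (\<gamma> (u, v)) \<inter> path_image (\<gamma> (x, y)) \<subseteq> p ` ({u, v} \<inter> {x, y})"
  shows "\<not> clique_minor V E 5"
proof
  assume "clique_minor V E 5"
  then obtain B :: "nat \<Rightarrow> 'a set" where B: "\<And>i. i < 5 \<Longrightarrow> B i \<subseteq> V \<and> B i \<noteq> {} \<and> cut_connected E (B i)"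
    and BB: "\<And>i j. i < 5 \<Longrightarrow> j < 5 \<Longrightarrow> i \<noteq> j \<Longrightarrow> B i \<inter> B j = {} \<and> (\<exists>x\<in>B i. \<exists>y\<in>B j. E x y)"
    by (elim clique_minorE) (rule that)
  have BV: "u \<in> V" if "i < 5" "u \<in> B i" for i u
    using B[OF that(1)] that(2) by blast
  have B_eq: "i = j" if "i < 5" "j < 5" "u \<in> B i" "u \<in> B j" for i j u
    using BB[of i j] that by blast
  define g where "g u v s = \<gamma> (u, v) s" for u v s
  have inj: "inj_on (g u v) {0..1}" if "E u v" for u v
    using arc[OF that] by (simp add: arc_def g_def[abs_def])
  have g_path: "path (g u v)" if "E u v" for u v
    using arc[OF that] by (simp add: arc_imp_path g_def[abs_def])
  have g01: "g u v 0 = p u" "g u v 1 = p v" if "E u v" for u v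
    using arc[OF that] by (simp_all add: pathstart_def pathfinish_def g_def)
  have g_rev: "g v u s = g u v (1 - s)" if "E u v" for u v s
    using arc[OF that] by (simp add: reversepath_def g_def)
  have g_im: "g u v s \<in> path_image (\<gamma> (u, v))" if "0 < s" "s < 1" for u v s
    using that by (simp add: path_image_def g_def)
  have interior: "g u v s \<notin> p ` V" if E: "E u v" and s: "0 < s" "s < 1" for u v s
  proof
    assume "g u v s \<in> p ` V"
    then have "g u v s \<in> {p u, p v}"
      using arc[OF E] g_im[OF s, of u v] by blast
    then have "g u v s = g u v 0 \<or> g u v s = g u v 1"
      using g01[OF E] by auto
    then show False
      using inj_onD[OF inj[OF E], of s 0] inj_onD[OF inj[OF E], of s 1] s by auto
  qed
  \<comment> \<open>An inner point of an edge determines the edge and the parameter, up to reversing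
    the direction.\<close>
  have coords: "u = x \<and> v = y \<and> s = r \<or> u = y \<and> v = x \<and> s = 1 - r"
    if E: "E u v" "E x y" and s: "0 < s" "s < 1" and r: "0 < r" "r < 1" and eq: "g u v s = g x y r" for u v x y s r
  proof (cases "{u, v} = {x, y}")
    case False
    have "g u v s \<in> p ` ({u, v} \<inter> {x, y})"
      using meet[OF E False] g_im[OF s, of u v] g_im[OF r, of x y] eq by auto
    then have "g u v s \<in> p ` V"
      using EV[OF E(1)] by auto
    then show ?thesis
      using interior[OF E(1) s] by blast
  next
    case True
    then consider "u = x" "v = y" | "u = y" "v = x"
      by (auto simp: doubleton_eq_iff)
    then show ?thesis
    proof cases
      case 1
      then show ?thesis
        using inj_onD[OF inj[OF E(1)], of s r] eq s r by auto
    next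
      case 2
      then have "g u v s = g u v (1 - r)"
        using eq g_rev[OF E(1), of r] by simp
      then show ?thesis
        using 2 inj_onD[OF inj[OF E(1)], of s "1 - r"] s r by auto
    qed
  qed
  have "\<forall>i j. \<exists>x y. i < 5 \<and> j < 5 \<and> i \<noteq> j \<longrightarrow> x \<in> B i \<and> y \<in> B j \<and> E x y"
    using BB by blast
  then obtain X Y where XY: "\<And>i j. i < 5 \<Longrightarrow> j < 5 \<Longrightarrow> i \<noteq> j \<Longrightarrow> X i j \<in> B i \<and> Y i j \<in> B j \<and> E (X i j) (Y i j)"
    by metis
  \<comment> \<open>\<open>a i j\<close> is the end in \<open>B i\<close> of the edge chosen between
    \<open>B i\<close> and \<open>B j\<close>. Comparing \<open>i\<close> with \<open>j\<close>
    makes both orders refer to the same edge.\<close>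
  define a where "a i j = (if i < j then X i j else Y j i)" for i j :: nat
  have a: "a i j \<in> B i" "E (a i j) (a j i)" if "i < 5" "j < 5" "i \<noteq> j" for i j
    using XY[of i j] XY[of j i] that sym by (auto simp: a_def)
  define C :: "nat \<Rightarrow> complex set" where "C i = p ` B i \<union> {g u v s | u v s. E u v \<and> u \<in> B i \<and> v \<in> B i \<and> 0 < s \<and> s < 1}
      \<union> {g (a i j) (a j i) s | j s. j < 5 \<and> j \<noteq> i \<and> 0 < s \<and> s \<le> 1/3}" for i
  define e where "e i j = g (a i j) (a j i) ` {1/3..2/3}" for i j
  define t where "t i j = g (a i j) (a j i) (1/3)" for i j
  \<comment> \<open>A normal form for the points of \<open>C i\<close>: read from an end in
    \<open>B i\<close>, the parameter is at most 1/3 unless the other end is in \<open>B i\<close>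
    as well.\<close>
  have C_cases: "(\<exists>u\<in>B i. z = p u) \<or>
      (\<exists>u v s. E u v \<and> z = g u v s \<and> 0 < s \<and> s < 1 \<and> u \<in> B i \<and> (v \<in> B i \<or> s \<le> 1/3))"
    if i: "i < 5" and z: "z \<in> C i" for i z
  proof -
    consider u where "u \<in> B i" "z = p u"
      | u v s where "E u v" "u \<in> B i" "v \<in> B i" "0 < s" "s < 1" "z = g u v s"
      | j s where "j < 5" "j \<noteq> i" "0 < s" "s \<le> 1/3" "z = g (a i j) (a j i) s"
      using z unfolding C_def by blast
    then show ?thesis
    proof cases
      case 3
      moreover have "s < 1"
        using 3 by simp
      ultimately show ?thesis
        using a[OF i 3(1)] by metis
    qed blast+
  qed
  have C_disj: "C i \<inter> C j = {}" if i: "i < 5" and j: "j < 5" and ij: "i \<noteq> j" for i j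
  proof (rule ccontr)
    assume "C i \<inter> C j \<noteq> {}"
    then obtain z where z: "z \<in> C i" "z \<in> C j"
      by blast
    show False
    proof (cases "z \<in> p ` V")
      case True
      then obtain u w where "u \<in> B i" "z = p u" "w \<in> B j" "z = p w"
        using C_cases[OF i z(1)] C_cases[OF j z(2)] interior by metis
      then have "u = w"
        using inj_onD[OF p] BV i j by metis
      then show False
        using B_eq i j ij \<open>u \<in> B i\<close> \<open>w \<in> B j\<close> by blast
    next
      case False
      then have nov: "\<not> (\<exists>u\<in>B i. z = p u)" "\<not> (\<exists>u\<in>B j. z = p u)"
        using BV[OF i] BV[OF j] by blast+
      obtain u v s where u: "E u v" "z = g u v s" "0 < s" "s < 1" "u \<in> B i" "v \<in> B i \<or> s \<le> 1/3"
        using C_cases[OF i z(1)] nov(1) by blast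
      obtain x y r where x: "E x y" "z = g x y r" "0 < r" "r < 1" "x \<in> B j" "y \<in> B j \<or> r \<le> 1/3"
        using C_cases[OF j z(2)] nov(2) by blast
      \<comment> \<open>The point lies on one edge between \<open>B i\<close> and
        \<open>B j\<close>, read from both ends; its two parameters add up to 1 and cannot both be
        at most 1/3.\<close>
      have "u \<noteq> x"
        using B_eq[OF i j] u(5) x(5) ij by blast
      then have eq: "u = y" "v = x" "s = 1 - r"
        using coords[OF u(1) x(1) u(3,4) x(3,4)] u(2) x(2) by auto
      then have "s \<le> 1/3" "r \<le> 1/3"
        using B_eq[OF i j] u(5,6) x(5,6) ij by auto
      then show False
        using eq(3) by simp
    qed
  qed
  have e_pt: "\<exists>s. z = g (a i j) (a j i) s \<and> 1/3 \<le> s \<and> s \<le> 2/3 \<and> 0 < s \<and> s < 1 \<and> z \<notin> p ` V"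
    if "i < 5" "j < 5" "i \<noteq> j" and z: "z \<in> e i j" for i j z
  proof -
    obtain s where s: "z = g (a i j) (a j i) s" "1/3 \<le> s" "s \<le> 2/3"
      using z unfolding e_def by auto
    then show ?thesis
      using interior[OF a(2)[OF that(1-3)], of s] by (intro exI[of _ s]) auto
  qed
  \<comment> \<open>The case \<open>k = j\<close> is left open here; it is the case
    \<open>k = i\<close> for \<open>e j i\<close>, the same link read backwards.\<close>
  have e_C: "k = i \<and> z = t i j \<or> k = j"
    if ij: "i < 5" "j < 5" "i \<noteq> j" and k: "k < 5" and z: "z \<in> e i j" "z \<in> C k" for i j k z
  proof -
    obtain s where s: "z = g (a i j) (a j i) s" "1/3 \<le> s" "s \<le> 2/3" "0 < s" "s < 1" "z \<notin> p ` V"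
      using e_pt[OF ij z(1)] by blast
    have "\<not> (\<exists>u\<in>B k. z = p u)"
      using s(6) BV[OF k] by blast
    then obtain u v r where u: "E u v" "z = g u v r" "0 < r" "r < 1" "u \<in> B k" "v \<in> B k \<or> r \<le> 1/3"
      using C_cases[OF k z(2)] by blast
    have ai: "a i j \<in> B i" "a j i \<in> B j"
      using a(1) ij by auto
    consider "a i j = u" "a j i = v" "s = r" | "a i j = v" "a j i = u" "s = 1 - r"
      using coords[OF a(2)[OF ij] u(1) s(4,5) u(3,4)] s(1) u(2) by auto
    then show ?thesis
    proof cases
      case 1
      then have "k = i"
        using B_eq[OF k ij(1)] u(5) ai by blast
      moreover have "v \<notin> B k"
        using B_eq[OF k ij(2)] ai 1(2) ij(3) calculation by blast
      ultimately have "s = 1/3"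
        using u(6) 1(3) s(2) by auto
      then have "z = t i j"
        using s(1) unfolding t_def by (rule back_subst[of "\<lambda>r. z = g (a i j) (a j i) r", rotated])
      then show ?thesis
        using \<open>k = i\<close> by blast
    next
      case 2
      then show ?thesis
        using B_eq[OF k ij(2)] u(5) ai by blast
    qed
  qed
  have t_e: "t i j \<in> e i j" for i j
    by (simp add: t_def e_def)
  have t_C: "t i j \<in> C i" if "i < 5" "j < 5" "i \<noteq> j" for i j
  proof -
    have "\<exists>j' s. t i j = g (a i j') (a j' i) s \<and> j' < 5 \<and> j' \<noteq> i \<and> 0 < s \<and> s \<le> 1/3"
      using that by (intro exI[of _ j] exI[of _ "1/3"]) (simp add: t_def)
    then show ?thesis
      unfolding C_def by blast
  qed
  have ee: "e i j \<inter> e k l = {}"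
    if ij: "i < 5" "j < 5" "i \<noteq> j" and kl: "k < 5" "l < 5" "k \<noteq> l" and ne: "{i, j} \<noteq> {k, l}" for i j k l
  proof (rule ccontr)
    assume "e i j \<inter> e k l \<noteq> {}"
    then obtain z where z: "z \<in> e i j" "z \<in> e k l"
      by blast
    obtain s where s: "z = g (a i j) (a j i) s" "0 < s" "s < 1"
      using e_pt[OF ij z(1)] by blast
    obtain r where r: "z = g (a k l) (a l k) r" "0 < r" "r < 1"
      using e_pt[OF kl z(2)] by blast
    have "a i j = a k l \<and> a j i = a l k \<or> a i j = a l k \<and> a j i = a k l"
      using coords[OF a(2)[OF ij] a(2)[OF kl] s(2,3) r(2,3)] s(1) r(1) by auto
    moreover have "a i j \<in> B i" "a j i \<in> B j" "a k l \<in> B k" "a l k \<in> B l"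
      using a(1) ij kl by auto
    ultimately have "i = k \<and> j = l \<or> i = l \<and> j = k"
      using B_eq ij kl by metis
    then show False
      using ne by auto
  qed
  have sub_pc: "path_component S x y" if "path_connected T" "T \<subseteq> S" "x \<in> T" "y \<in> T" for S T and x y :: complex
    using that by (meson path_component_of_subset path_connected_component)
  have pc: "path_connected (C i)" if i: "i < 5" for i
  proof -
    obtain w where w: "w \<in> B i"
      using B[OF i] by blast
    have seg: "path_connected (g u v ` {0..s})" if "E u v" "s \<le> 1" for u v s
      using path_connected_subarc[OF g_path[OF that(1)], of 0 s] that(2) by simp
    have inC1: "g u v ` {0..s} \<subseteq> C i" if uv: "E u v" "u \<in> B i" "v \<in> B i" "s \<le> 1" for u v s
    proof
      fix z assume "z \<in> g u v ` {0..s}"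
      then obtain r where r: "z = g u v r" "0 \<le> r" "r \<le> 1"
        using uv(4) by auto
      consider "r = 0" | "r = 1" | "0 < r" "r < 1"
        using r by linarith
      then show "z \<in> C i"
      proof cases
        case 3
        then have "\<exists>u v s. z = g u v s \<and> E u v \<and> u \<in> B i \<and> v \<in> B i \<and> 0 < s \<and> s < 1"
          using r(1) uv by blast
        then show ?thesis unfolding C_def by blast
      qed (use r g01[OF uv(1)] uv in \<open>simp_all add: C_def\<close>)
    qed
    have inC2: "g (a i j) (a j i) ` {0..s} \<subseteq> C i" if j: "j < 5" "j \<noteq> i" and s: "s \<le> 1/3" for j s
    proof
      fix z assume "z \<in> g (a i j) (a j i) ` {0..s}"
      then obtain r where r: "z = g (a i j) (a j i) r" "0 \<le> r" "r \<le> 1/3"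
        using s by auto
      have aj: "a i j \<in> B i" "E (a i j) (a j i)"
        using a[OF i j(1)] j(2) by auto
      show "z \<in> C i"
      proof (cases "r = 0")
        case True
        then show ?thesis
          using r g01(1)[OF aj(2)] aj(1) by (simp add: C_def)
      next
        case False
        then have "\<exists>j s. z = g (a i j) (a j i) s \<and> j < 5 \<and> j \<noteq> i \<and> 0 < s \<and> s \<le> 1/3"
          using r j by (intro exI[of _ j] exI[of _ r]) simp
        then show ?thesis unfolding C_def by blast
      qed
    qed
    \<comment> \<open>The vertices of \<open>B i\<close> reachable from \<open>w\<close> within
      \<open>C i\<close>. If some were missing, \<open>cut_connected\<close> would provide an edge
      leaving \<open>?A\<close>, and its curve lies in \<open>C i\<close>.\<close>
    let ?A = "{u \<in> B i. path_component (C i) (p w) (p u)}"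
    have "p w \<in> C i"
      using w by (simp add: C_def)
    then have "w \<in> ?A"
      using w by (simp add: path_component_refl)
    have "?A = B i"
    proof (rule ccontr)
      assume "?A \<noteq> B i"
      moreover have "?A \<subseteq> B i" "?A \<noteq> {}"
        using \<open>w \<in> ?A\<close> by blast+
      moreover have "cut_connected E (B i)"
        using B[OF i] by simp
      ultimately obtain u v where u: "u \<in> ?A" and v: "v \<in> B i - ?A" and uv: "E u v"
        unfolding cut_connected_def by meson
      have "p u \<in> g u v ` {0..1}" "p v \<in> g u v ` {0..1}"
        using g01[OF uv] by (metis atLeastAtMost_iff imageI order_refl zero_le_one)+
      then have "path_component (C i) (p u) (p v)"
        using sub_pc[OF seg[OF uv order_refl] inC1[OF uv _ _ order_refl]] u v by blast
      then show False
        using u v path_component_trans[of "C i" "p w" "p u" "p v"] by blast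
    qed
    then have vert: "path_component (C i) (p w) (p u)" if "u \<in> B i" for u
      using that by blast
    have all: "path_component (C i) (p w) z" if z: "z \<in> C i" for z
    proof -
      have join: "path_component (C i) (p w) z"
        if uv: "E u v" "u \<in> B i" and s: "0 \<le> s" "s \<le> 1" "z = g u v s" and sub: "g u v ` {0..s} \<subseteq> C i" for u v s
      proof -
        have "p u \<in> g u v ` {0..s}" "z \<in> g u v ` {0..s}"
          using g01(1)[OF uv(1)] s imageI[of 0 "{0..s}" "g u v"] by auto
        then have "path_component (C i) (p u) z"
          using sub_pc[OF seg[OF uv(1) s(2)] sub] by blast
        then show ?thesis
          using vert[OF uv(2)] path_component_trans by blast
      qed
      consider u where "u \<in> B i" "z = p u"
        | u v s where "E u v" "u \<in> B i" "v \<in> B i" "0 < s" "s < 1" "z = g u v s"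
        | j s where "j < 5" "j \<noteq> i" "0 < s" "s \<le> 1/3" "z = g (a i j) (a j i) s"
        using z unfolding C_def by blast
      then show ?thesis
      proof cases
        case 1
        then show ?thesis using vert by simp
      next
        case 2
        then show ?thesis
          using join[OF 2(1,2) _ _ 2(6) inC1[OF 2(1-3)]] by simp
      next
        case 3
        have "a i j \<in> B i" "E (a i j) (a j i)"
          using a[OF i 3(1)] 3(2) by auto
        then show ?thesis
          using join[OF _ _ _ _ 3(5) inC2[OF 3(1,2,4)]] 3(3,4) by simp
      qed
    qed
    show ?thesis
      unfolding path_connected_component using all path_component_sym path_component_trans by metis
  qed
  have "fat_drawing 5 (\<lambda>i j. True) C e t"
    unfolding fat_drawing_def
  proof (intro conjI allI impI, goal_cases)
    case (1 i)
    then show ?case by (rule pc)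
  next
    case (2 i j)
    then show ?case by (rule C_disj)
  next
    case (3 i j)
    then have "path (g (a i j) (a j i))"
      using a(2)[of i j] g_path by simp
    then show ?case
      unfolding e_def by (rule path_connected_subarc) simp_all
  next
    case 4
    then show ?case by simp
  next
    case (5 i j)
    then have E: "E (a i j) (a j i)"
      using a(2)[of i j] by simp
    have "e j i = (\<lambda>s. g (a i j) (a j i) (1 - s)) ` {1/3..2/3}"
      unfolding e_def using g_rev[OF E] by simp
    also have "\<dots> = g (a i j) (a j i) ` ((\<lambda>s. 1 - s) ` {1/3..2/3})"
      unfolding image_image ..
    also have "(\<lambda>s. 1 - s) ` {1/3..2/3} = {1/3..2/3::real}"
      by (simp add: image_diff_atLeastAtMost)
    finally show ?case
      unfolding e_def ..
  next
    case (6 i j)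
    then have ij: "i < 5" "j < 5" "i \<noteq> j"
      by simp_all
    show ?case
      using e_C[OF ij ij(1)] t_e[of i j] t_C[OF ij] ij(3) by blast
  next
    case (7 i j k)
    then show ?case
      using e_C[of i j k] by blast
  next
    case (8 i j k l)
    then have "e i j \<inter> e k l = {}"
      by (intro ee) simp_all
    then show ?case by simp
  qed
  then show False
    using ee by (rule no_fat_drawing_K5)
qed

theorem theorem9:
  fixes G :: "'a pair_pre_digraph"
  assumes "pair_graph G"
    and "planar G"
    and "\<forall>v \<in> pverts G. neighbors G v \<noteq> {}"
  shows "\<exists>c. open_conflict_free_coloring G 8 c"
proof -
  let ?E = "\<lambda>u v. (u, v) \<in> parcs G"
  obtain p \<gamma> where dr: "plane_drawing G p \<gamma>"
    using assms(2) by (auto simp: planar_def)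
  have fin: "finite (pverts G)" and sym: "\<And>u v. ?E u v \<Longrightarrow> ?E v u" and irr: "\<And>u. \<not> ?E u u"
    and EV: "\<And>u v. ?E u v \<Longrightarrow> u \<in> pverts G \<and> v \<in> pverts G"
  proof -
    interpret pair_graph G by fact
    show "finite (pverts G)"
      by (rule pair_finite_verts)
    show "?E v u" if "?E u v" for u v
      using that by (rule arcs_symmetric)
    show "\<not> ?E u u" for u
      using pair_no_loops[of "(u, u)"] by auto
    show "u \<in> pverts G \<and> v \<in> pverts G" if "?E u v" for u v
      using in_arcsD1[OF that] in_arcsD2[OF that] by simp
  qed
  have "\<not> clique_minor (pverts G) ?E 5"
  proof (rule plane_graph_no_K5_minor[where E = ?E, OF sym irr EV])
    show "inj_on p (pverts G)"
      using dr by (simp add: plane_drawing_def)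
  next
    fix u v assume "?E u v"
    then show "arc (\<gamma> (u, v)) \<and> pathstart (\<gamma> (u, v)) = p u \<and> pathfinish (\<gamma> (u, v)) = p v \<and>
        \<gamma> (v, u) = reversepath (\<gamma> (u, v)) \<and> path_image (\<gamma> (u, v)) \<inter> p ` pverts G = {p u, p v}"
      using dr unfolding plane_drawing_def by blast
  next
    fix u v x y assume "?E u v" "?E x y" "{u, v} \<noteq> {x, y}"
    then show "path_image (\<gamma> (u, v)) \<inter> path_image (\<gamma> (x, y)) \<subseteq> p ` ({u, v} \<inter> {x, y})"
      using dr unfolding plane_drawing_def by blast
  qed
  moreover have "\<exists>w. ?E v w" if "v \<in> pverts G" for v
    using assms(3) that by (auto simp: neighbors_def)
  ultimately show ?thesis
    using K5_minor_free_imp_conflict_free[where E = ?E, OF fin sym irr EV]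
    unfolding open_conflict_free_coloring_def neighbors_def by blast
qed

end
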